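(* Let $r>0$ and $a>0$. Then the problem of $n_\varepsilon(U^{r,a}_*(\mathbb T^s),L_2(\mathbb T^s))$ (as a function of $\varepsilon\in(0,1]$ and $s\in\mathbb N$) is weakly tractable but polynomially intractable, where $U^{r,a}_*(\mathbb T^s):=a^{rs}\,U^{r,a}(\mathbb T^s)=\{f\in K^{r,a}(\mathbb T^s):\ \|f\|_{K^{r,a}(\mathbb T^s)}\le a^{rs}\}$.
   Context: $\mathbb N=\{1,2,\dots\}$. $\mathbb T^s=[-\pi,\pi]^s$ is the $s$-dimensional torus, and $L_2(\mathbb T^s)$ carries the inner product $(f,g)=(2\pi)^{-s}\int_{\mathbb T^s}f(\mathbf x)\overline{g(\mathbf x)}\,d\mathbf x$ and norm $\|f\|=(f,f)^{1/2}$. For $\mathbf k\in\mathbb Z^s$, $e_{\mathbf k}(\mathbf x)=e^{i(\mathbf k,\mathbf x)}$, $\hat f(\mathbf k)=(f,e_{\mathbf k})$. For $a>0$ put $\lambda_a(\mathbf k):=\prod_{j=1}^s(a+|k_j|)$. The modified Korobov space $K^{r,a}(\mathbb T^s)$ is the Hilbert space of all $f=\kappa_{r,a}*g$ with $g\in L_2(\mathbb T^s)$, where $\kappa_{r,a}=\sum_{\mathbf k\in\mathbb Z^s}\lambda_a(\mathbf k)^{-r}e_{\mathbf k}$ (in the distributional sense), i.e. $\hat f(\mathbf k)=\lambda_a(\mathbf k)^{-r}\hat g(\mathbf k)$, with norm $\|f\|_{K^{r,a}(\mathbb T^s)}:=\|g\|$; equivalently $\|f\|^2_{K^{r,a}(\mathbb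 T^s)}=\sum_{\mathbf k}\lambda_a(\mathbf k)^{2r}|\hat f(\mathbf k)|^2$. $U^{r,a}(\mathbb T^s)$ is its (closed) unit ball. For a normed space $X$ and $W\subset X$ centrally symmetric, $n_\varepsilon(W,X)$ is the smallest $n\in\mathbb N_0$ such that some linear subspace $L\subset X$ of dimension $\le n$ satisfies $\sup_{f\in W}\inf_{g\in L}\|f-g\|_X\le\varepsilon$. For a family $W=W_s\subset L_2(\mathbb T^s)$, $s\in\mathbb N$, with $n_\varepsilon=n_\varepsilon(W_s,L_2(\mathbb T^s))$, $\varepsilon\in(0,1]$: the problem is weakly tractable if $\lim_{\varepsilon^{-1}+s\to\infty}\frac{\ln n_\varepsilon}{\varepsilon^{-1}+s}=0$ (with the convention $\ln 0:=0$); it is polynomially tractable if there are nonnegative $C,p,q$ with $n_\varepsilon\le C s^q\varepsilon^{-p}$ for all $\varepsilon\in(0,1]$, $s\in\mathbb N$, and polynomially intractable otherwise. *)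

theory Defs
  imports "HOL-Probability.Probability" "HOL-Library.Function_Algebras"
begin

text \<open>Since the dimension s varies inside the statement, points of the torus and frequencies are
  functions on \<^term>\<open>nat\<close> of which only the coordinates \<^term>\<open>{1..s}\<close> are used.\<close>

definition torus :: "nat \<Rightarrow> (nat \<Rightarrow> real) measure" where
  "torus s = PiM {1..s} (\<lambda>_. restrict_space lborel {-pi..pi})"

text \<open>\<^term>\<open>L2\<close> consists of functions rather than classes modulo equality almost everywhere, so
  \<^term>\<open>L2_norm s\<close> below is a seminorm whose kernel is the set of null functions. The quantities defined
  from it are the same as in the quotient space.\<close>

definition L2 :: "nat \<Rightarrow> ((nat \<Rightarrow> real) \<Rightarrow> complex) set" where
  "L2 s = {f \<in> borel_measurable (torus s). integrable (torus s) (\<lambda>x. (cmod (f x))\<^sup>2)}"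

definition L2_inner :: "nat \<Rightarrow> ((nat \<Rightarrow> real) \<Rightarrow> complex) \<Rightarrow> ((nat \<Rightarrow> real) \<Rightarrow> complex) \<Rightarrow> complex" where
  "L2_inner s f g = (LINT x|torus s. f x * cnj (g x)) / complex_of_real ((2 * pi) ^ s)"

definition L2_norm :: "nat \<Rightarrow> ((nat \<Rightarrow> real) \<Rightarrow> complex) \<Rightarrow> real" where
  "L2_norm s f = sqrt (Re (L2_inner s f f))"

definition freqs :: "nat \<Rightarrow> (nat \<Rightarrow> int) set" where
  "freqs s = {1..s} \<rightarrow>\<^sub>E UNIV"

definition char_fun :: "nat \<Rightarrow> (nat \<Rightarrow> int) \<Rightarrow> (nat \<Rightarrow> real) \<Rightarrow> complex" where
  "char_fun s k x = exp (\<i> * complex_of_real (\<Sum>j=1..s. of_int (k j) * x j))"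

definition fourier_coeff :: "nat \<Rightarrow> ((nat \<Rightarrow> real) \<Rightarrow> complex) \<Rightarrow> (nat \<Rightarrow> int) \<Rightarrow> complex" where
  "fourier_coeff s f k = L2_inner s f (char_fun s k)"

definition korobov_weight :: "nat \<Rightarrow> real \<Rightarrow> (nat \<Rightarrow> int) \<Rightarrow> real" where
  "korobov_weight s a k = (\<Prod>j=1..s. a + of_int \<bar>k j\<bar>)"

text \<open>\<^term>\<open>korobov_conv s r a g f\<close> says that f is the distributional convolution of g with
  the kernel whose Fourier coefficients are \<^term>\<open>korobov_weight s a k powr (- r)\<close>.\<close>

definition korobov_conv ::
  "nat \<Rightarrow> real \<Rightarrow> real \<Rightarrow> ((nat \<Rightarrow> real) \<Rightarrow> complex) \<Rightarrow> ((nat \<Rightarrow> real) \<Rightarrow> complex) \<Rightarrow> bool" where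
  "korobov_conv s r a g f \<longleftrightarrow>
     (\<forall>k\<in>freqs s. fourier_coeff s f k
        = complex_of_real (korobov_weight s a k powr (- r)) * fourier_coeff s g k)"

definition korobov_space :: "nat \<Rightarrow> real \<Rightarrow> real \<Rightarrow> ((nat \<Rightarrow> real) \<Rightarrow> complex) set" where
  "korobov_space s r a = {f \<in> L2 s. \<exists>g\<in>L2 s. korobov_conv s r a g f}"

text \<open>g is determined by f up to a null set, hence its norm is determined by f.\<close>

definition korobov_norm :: "nat \<Rightarrow> real \<Rightarrow> real \<Rightarrow> ((nat \<Rightarrow> real) \<Rightarrow> complex) \<Rightarrow> real" where
  "korobov_norm s r a f = (THE c. \<exists>g\<in>L2 s. korobov_conv s r a g f \<and> c = L2_norm s g)"

definition korobov_ball_star :: "real \<Rightarrow> real \<Rightarrow> nat \<Rightarrow> ((nat \<Rightarrow> real) \<Rightarrow> complex) set" where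
  "korobov_ball_star r a s =
     {f \<in> korobov_space s r a. korobov_norm s r a f \<le> a powr (r * real s)}"

definition cscale :: "complex \<Rightarrow> ('x \<Rightarrow> complex) \<Rightarrow> 'x \<Rightarrow> complex" where
  "cscale c f = (\<lambda>x. c * f x)"

interpretation cfun: vector_space cscale
  by unfold_locales (auto simp: cscale_def fun_eq_iff algebra_simps)

text \<open>The value is \<^term>\<open>\<infinity>\<close> if no finite-dimensional subspace is good enough. The bound on the
  dimension is expressed by a finite spanning set because \<^term>\<open>cfun.dim\<close> is 0 on
  infinite-dimensional subspaces.\<close>

definition n_eps ::
  "real \<Rightarrow> ('x \<Rightarrow> complex) set \<Rightarrow> ('x \<Rightarrow> complex) set \<Rightarrow> (('x \<Rightarrow> complex) \<Rightarrow> real) \<Rightarrow> enat" where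
  "n_eps \<epsilon> W X nrm = Inf {enat n | n. \<exists>L. cfun.subspace L \<and> L \<subseteq> X \<and>
     (\<exists>B. finite B \<and> card B \<le> n \<and> cfun.span B = L) \<and>
     (SUP f\<in>W. INF g\<in>L. ereal (nrm (f - g))) \<le> ereal \<epsilon>}"

definition ln_enat :: "enat \<Rightarrow> ereal" where
  "ln_enat n = (case n of enat m \<Rightarrow> if m = 0 then 0 else ereal (ln (real m)) | \<infinity> \<Rightarrow> \<infinity>)"

text \<open>The limit is over all pairs (s, \<epsilon>) with s positive and \<epsilon> in (0, 1], jointly.\<close>

definition weakly_tractable :: "(nat \<Rightarrow> ((nat \<Rightarrow> real) \<Rightarrow> complex) set) \<Rightarrow> bool" where
  "weakly_tractable W \<longleftrightarrow>
     ((\<lambda>(s, \<epsilon>). ln_enat (n_eps \<epsilon> (W s) (L2 s) (L2_norm s)) / ereal (1 / \<epsilon> + real s)) \<longlongrightarrow> 0)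
       (filtercomap (\<lambda>(s, \<epsilon>). 1 / \<epsilon> + real s) at_top \<sqinter> principal ({1..} \<times> {0<..1}))"

definition polynomially_tractable :: "(nat \<Rightarrow> ((nat \<Rightarrow> real) \<Rightarrow> complex) set) \<Rightarrow> bool" where
  "polynomially_tractable W \<longleftrightarrow>
     (\<exists>C\<ge>0. \<exists>p\<ge>0. \<exists>q\<ge>0. \<forall>\<epsilon>\<in>{0<..1}. \<forall>s\<ge>1.
        ereal_of_enat (n_eps \<epsilon> (W s) (L2 s) (L2_norm s))
          \<le> ereal (C * real s powr q * \<epsilon> powr (- p)))"

abbreviation polynomially_intractable :: "(nat \<Rightarrow> ((nat \<Rightarrow> real) \<Rightarrow> complex) set) \<Rightarrow> bool" where
  "polynomially_intractable W \<equiv> \<not> polynomially_tractable W"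

end

theory Submission
  imports Defs
begin

text \<open>The exponentials \<^term>\<open>char_fun s k\<close> form a complete orthonormal system. Completeness: bounded
  limits of trigonometric polynomials form an algebra, so the sets whose indicators are such limits
  form a sigma-algebra; it contains all boxes because a coordinate is almost everywhere a measurable
  function of its sine and cosine.

  The Korobov kernel acts diagonally on this system, so n_eps is essentially the number of
  frequencies k for which w k = (\<Prod>j. 1 + |k j| / a) is below \<epsilon> powr (-1/r): their span approximates
  the ball up to \<epsilon>, and it meets the orthogonal complement of any subspace of smaller dimension in a
  ball element of norm above \<epsilon>. Weak tractability follows from Rankin's trick with exponent p, since
  the sum of (1 + |i| / a) powr (-p) over all integers i tends to 1 as p grows. Polynomial
  tractability fails because the 0-1 frequencies with l nonzero entries all have w k = (1 + 1/a)^l,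
  which is independent of s, and there are s choose l of them.\<close>

subsection \<open>Exponentials on the torus\<close>

text \<open>Completeness is what turns the diagonal action into statements about norms. It bounds
  the approximation error by Fourier coefficients, and it makes \<open>korobov_norm\<close> well
  defined, because the norm of g must be determined by the coefficients of f alone. Uniform
  approximation on all of \<open>torus s\<close> is obstructed: every exponential takes equal values
  when a coordinate is changed from -pi to pi. This is why completeness is reached through sets and
  null sets. In the counting bound, any fixed exponent p leaves a factor that is exponential in s,
  which is too much for weak tractability. Hence p is chosen only after the tolerance \<eta> is
  given, large enough for the exponential rate in s to fall below \<eta>. The price is a factor
  \<open>\<epsilon> powr (- p / r)\<close>, and for each fixed p its logarithm is negligible against
  1 / \<epsilon>.\<close>

lemma finite_measure_interval: "finite_measure (restrict_space lborel {-pi..pi::real})"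
  by (rule finite_measureI) (simp add: emeasure_restrict_space space_restrict_space)

lemma product_sigma_finite_interval:
  "product_sigma_finite (\<lambda>_::nat. restrict_space lborel {-pi..pi::real})"
  using finite_measure_interval
  by (simp add: product_sigma_finite_def finite_measure_def)

lemma space_torus: "space (torus s) = {1..s} \<rightarrow>\<^sub>E {-pi..pi}"
  by (simp add: torus_def space_PiM space_restrict_space)

lemma emeasure_torus_box:
  assumes "\<And>i. i \<in> {1..s} \<Longrightarrow> A i \<in> sets borel \<and> A i \<subseteq> {-pi..pi}"
  shows "Pi\<^sub>E {1..s} A \<in> sets (torus s)"
    and "emeasure (torus s) (Pi\<^sub>E {1..s} A) = (\<Prod>i\<in>{1..s}. emeasure lborel (A i))"
proof -
  have 1: "A i \<in> sets (restrict_space lborel {-pi..pi})" if "i \<in> {1..s}" for i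
    using assms[OF that] by (auto simp: sets_restrict_space)
  then show "Pi\<^sub>E {1..s} A \<in> sets (torus s)"
    unfolding torus_def by (intro sets_PiM_I_finite) auto
  have "emeasure (torus s) (Pi\<^sub>E {1..s} A)
      = (\<Prod>i\<in>{1..s}. emeasure (restrict_space lborel {-pi..pi}) (A i))"
    unfolding torus_def
    using 1 by (intro product_sigma_finite.emeasure_PiM product_sigma_finite_interval) auto
  also have "\<dots> = (\<Prod>i\<in>{1..s}. emeasure lborel (A i))"
    using assms by (intro prod.cong refl) (auto simp: emeasure_restrict_space)
  finally show "emeasure (torus s) (Pi\<^sub>E {1..s} A) = (\<Prod>i\<in>{1..s}. emeasure lborel (A i))" .
qed

lemma emeasure_torus: "emeasure (torus s) (space (torus s)) = ennreal ((2 * pi) ^ s)"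
  unfolding space_torus by (subst emeasure_torus_box(2)) (auto simp: ennreal_power)

lemma finite_measure_torus: "finite_measure (torus s)"
  by (rule finite_measureI) (simp add: emeasure_torus)

lemma coordinate_measurable [measurable]:
  "j \<in> {1..s} \<Longrightarrow> (\<lambda>x. x j) \<in> borel_measurable (torus s)"
  unfolding torus_def
  by (rule measurable_compose[OF measurable_component_singleton]) (auto simp: measurable_restrict_space1)

text \<open>The slice is a box with one side of length 0. It is applied with \<open>c\<close> equal
  to -pi and to pi, the two coordinate values that sine and cosine do not separate.\<close>

lemma AE_torus_coordinate_neq:
  assumes j: "j \<in> {1..s}" and c: "c \<in> {-pi..pi}"
  shows "AE x in torus s. x j \<noteq> c"
proof (rule AE_I')
  define A where "A i = (if i = j then {c} else {-pi..pi})" for i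
  have A: "A i \<in> sets borel \<and> A i \<subseteq> {-pi..pi}" for i
    using c by (auto simp: A_def)
  show "Pi\<^sub>E {1..s} A \<in> null_sets (torus s)"
    using emeasure_torus_box[of s A] A j by (force simp: null_sets_def A_def)
  show "{x \<in> space (torus s). \<not> x j \<noteq> c} \<subseteq> Pi\<^sub>E {1..s} A"
    unfolding space_torus
  proof (intro subsetI PiE_I)
    fix x i
    assume x: "x \<in> {x \<in> {1..s} \<rightarrow>\<^sub>E {-pi..pi}. \<not> x j \<noteq> c}"
    show "x i \<in> A i" if "i \<in> {1..s}"
      using x that PiE_mem[of x "{1..s}" "\<lambda>_. {-pi..pi}" i] by (simp add: A_def)
    show "x i = undefined" if "i \<notin> {1..s}"
      using x that PiE_arb[of x "{1..s}" "\<lambda>_. {-pi..pi}" i] by simp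
  qed
qed

lemma integral_exp_interval:
  "(LINT x|restrict_space lborel {-pi..pi}. exp (\<i> * complex_of_real (of_int m * x)))
     = (if m = 0 then complex_of_real (2 * pi) else 0)"
proof (cases "m = 0")
  case True
  have "(2 * pi) *\<^sub>R 1 = complex_of_real (2 * pi)"
    by (rule scaleR_conv_of_real[of _ "1::complex", simplified mult_1_right])
  with True show ?thesis
    by (simp add: measure_def emeasure_restrict_space space_restrict_space)
next
  case False
  define f where "f z = exp (\<i> * (of_int m * z)) / (\<i> * of_int m)" for z :: complex
  define F where "F x = f (complex_of_real x)" for x
  have f: "(f has_field_derivative exp (\<i> * (of_int m * z))) (at z)" for z
  proof -
    have nz: "\<i> * of_int m \<noteq> (0::complex)" using False by simp
    have "((\<lambda>z. exp (\<i> * (of_int m * z))) has_field_derivative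
        exp (\<i> * (of_int m * z)) * (\<i> * of_int m)) (at z)"
      by (rule derivative_eq_intros refl)+ simp
    from DERIV_cdivide[OF this, of "\<i> * of_int m"] show ?thesis
      unfolding f_def by (simp only: nonzero_mult_div_cancel_right[OF nz])
  qed
  have F: "(F has_vector_derivative exp (\<i> * complex_of_real (of_int m * x))) (at x within {-pi..pi})" for x
    unfolding F_def using has_vector_derivative_real_field[OF f, of x "{-pi..pi}"] by simp
  have "(LINT x|restrict_space lborel {-pi..pi}. exp (\<i> * complex_of_real (of_int m * x)))
      = (LBINT x. indicat_real {-pi..pi} x *\<^sub>R exp (\<i> * complex_of_real (of_int m * x)))"
    by (subst integral_restrict_space) (auto simp: set_lebesgue_integral_def)
  also have "\<dots> = F pi - F (-pi)"
  proof (rule integral_FTC_Icc[OF _ F])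
    show "continuous_on {- pi..pi} (\<lambda>x. exp (\<i> * complex_of_real (of_int m * x)))"
      by (intro continuous_intros)
  qed simp
  also have "\<dots> = 0"
  proof -
    \<comment> \<open>The exponents at pi and -pi differ by 2 pi i m. The rule \<open>exp_eq\<close>
      asks for the number of full periods, so the witness is \<open>m\<close> itself.\<close>
    have "exp (\<i> * (of_int m * complex_of_real pi)) = exp (\<i> * (of_int m * complex_of_real (-pi)))"
      unfolding exp_eq by (rule exI[of _ m]) (simp add: algebra_simps)
    then show ?thesis unfolding F_def f_def by (simp only: diff_self)
  qed
  finally show ?thesis using False by simp
qed

lemma char_fun_measurable [measurable]: "char_fun s k \<in> borel_measurable (torus s)"
  unfolding char_fun_def by measurable

lemma norm_char_fun [simp]: "cmod (char_fun s k x) = 1"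
  by (simp add: char_fun_def)

lemma char_fun_mult: "char_fun s k x * char_fun s l x = char_fun s (\<lambda>j. k j + l j) x"
  by (simp add: char_fun_def mult_exp_exp flip: distrib_left of_real_add sum.distrib)
     (simp add: algebra_simps)

lemma cnj_char_fun: "cnj (char_fun s k x) = char_fun s (\<lambda>j. - k j) x"
  by (simp add: char_fun_def exp_cnj sum_negf)

lemma char_fun_cong: "(\<And>j. j \<in> {1..s} \<Longrightarrow> k j = l j) \<Longrightarrow> char_fun s k = char_fun s l"
  by (auto simp: char_fun_def fun_eq_iff intro!: sum.cong arg_cong[where f = exp])

lemma integral_char_fun:
  "(LINT x|torus s. char_fun s k x) = (if \<forall>j\<in>{1..s}. k j = 0 then complex_of_real ((2 * pi) ^ s) else 0)"
proof -
  \<comment> \<open>The exponential of a sum is a product of functions of one coordinate each, so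
    its integral over the product measure factorises.\<close>
  have eq: "char_fun s k = (\<lambda>x. \<Prod>j\<in>{1..s}. exp (\<i> * complex_of_real (of_int (k j) * x j)))"
    by (simp add: char_fun_def fun_eq_iff sum_distrib_left exp_sum)
  have "(LINT x|torus s. char_fun s k x)
     = (\<Prod>j\<in>{1..s}. LINT x|restrict_space lborel {-pi..pi}. exp (\<i> * complex_of_real (of_int (k j) * x)))"
    unfolding eq torus_def
  proof (rule product_sigma_finite.product_integral_prod[OF product_sigma_finite_interval])
    fix i
    interpret finite_measure "restrict_space lborel {-pi..pi::real}" by (rule finite_measure_interval)
    show "integrable (restrict_space lborel {-pi..pi}) (\<lambda>x. exp (\<i> * complex_of_real (of_int (k i) * x)))"
      by (rule integrable_const_bound[where B = 1]) (auto intro!: measurable_restrict_space1)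
  qed simp
  also have "\<dots> = (\<Prod>j\<in>{1..s}. if k j = 0 then complex_of_real (2 * pi) else 0)"
    by (simp only: integral_exp_interval)
  also have "\<dots> = (if \<forall>j\<in>{1..s}. k j = 0 then complex_of_real ((2 * pi) ^ s) else 0)"
  proof (cases "\<forall>j\<in>{1..s}. k j = 0")
    case True
    then have "(\<Prod>j\<in>{1..s}. if k j = 0 then complex_of_real (2 * pi) else 0)
      = (\<Prod>j\<in>{1..s}. complex_of_real (2 * pi))" by (intro prod.cong) auto
    then show ?thesis using True by simp
  qed (auto intro!: prod_zero)
  finally show ?thesis .
qed

lemma L2_inner_char_fun:
  assumes "k \<in> freqs s" "l \<in> freqs s"
  shows "L2_inner s (char_fun s k) (char_fun s l) = (if k = l then 1 else 0)"
proof -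
  \<comment> \<open>Elements of \<open>freqs s\<close> are extensional, so agreement on
    \<open>{1..s}\<close> is equality of functions.\<close>
  have "(\<forall>j\<in>{1..s}. k j - l j = 0) \<longleftrightarrow> k = l"
    using assms PiE_ext[of k "{1..s}" "\<lambda>_. UNIV" l] unfolding freqs_def by fastforce
  then show ?thesis
    by (simp add: L2_inner_def cnj_char_fun char_fun_mult integral_char_fun)
qed

subsection \<open>The inner product and Bessel's identity\<close>

lemma sum_fun_apply: "(\<Sum>i\<in>A. f i) x = (\<Sum>i\<in>A. f i x)"
  for f :: "'i \<Rightarrow> 'x \<Rightarrow> complex"
  by (induction A rule: infinite_finite_induct) auto

lemma L2_measurable [measurable_dest]: "f \<in> L2 s \<Longrightarrow> f \<in> borel_measurable (torus s)"
  by (simp add: L2_def)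

lemma L2_integrable: "f \<in> L2 s \<Longrightarrow> integrable (torus s) (\<lambda>x. (cmod (f x))\<^sup>2)"
  by (simp add: L2_def)

lemma L2_bounded:
  assumes "f \<in> borel_measurable (torus s)" and "\<And>x. x \<in> space (torus s) \<Longrightarrow> cmod (f x) \<le> B"
  shows "f \<in> L2 s"
proof -
  interpret finite_measure "torus s" by (rule finite_measure_torus)
  have "integrable (torus s) (\<lambda>x. (cmod (f x))\<^sup>2)"
    using assms by (intro integrable_const_bound[where B = "B\<^sup>2"]) (auto intro!: power_mono)
  then show ?thesis using assms by (simp add: L2_def)
qed

lemma L2_cscale: "f \<in> L2 s \<Longrightarrow> cscale c f \<in> L2 s"
  by (auto simp: L2_def cscale_def norm_mult power_mult_distrib)

lemma norm_add_sq_le: "(norm (x + y))\<^sup>2 \<le> 2 * (norm x)\<^sup>2 + 2 * (norm y)\<^sup>2"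
proof -
  have "(norm (x + y))\<^sup>2 \<le> (norm x + norm y)\<^sup>2"
    by (intro power_mono norm_triangle_ineq) auto
  also have "\<dots> \<le> 2 * (norm x)\<^sup>2 + 2 * (norm y)\<^sup>2"
    using sum_squares_bound[of "norm x" "norm y"] by (simp add: power2_sum)
  finally show ?thesis .
qed

lemma L2_add:
  assumes "f \<in> L2 s" "g \<in> L2 s"
  shows "f + g \<in> L2 s"
proof -
  have m [measurable]: "f \<in> borel_measurable (torus s)" "g \<in> borel_measurable (torus s)"
    using assms by (auto simp: L2_def)
  have "integrable (torus s) (\<lambda>x. (cmod (f x + g x))\<^sup>2)"
    by (rule Bochner_Integration.integrable_bound
        [where f = "\<lambda>x. 2 * (cmod (f x))\<^sup>2 + 2 * (cmod (g x))\<^sup>2"])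
       (use assms norm_add_sq_le in \<open>auto simp: L2_integrable\<close>)
  then show ?thesis by (simp add: L2_def plus_fun_def)
qed

lemma L2_diff: "f \<in> L2 s \<Longrightarrow> g \<in> L2 s \<Longrightarrow> f - g \<in> L2 s"
  using L2_add[OF _ L2_cscale[of g s "-1"], of f] by (simp add: cscale_def plus_fun_def fun_diff_def)

lemma L2_zero: "0 \<in> L2 s"
  by (simp add: L2_def zero_fun_def)

lemma L2_sum: "(\<And>i. i \<in> A \<Longrightarrow> f i \<in> L2 s) \<Longrightarrow> (\<Sum>i\<in>A. f i) \<in> L2 s"
  by (induction A rule: infinite_finite_induct) (auto intro: L2_add L2_zero)

lemma L2_subspace: "cfun.subspace (L2 s)"
  by (simp add: cfun.subspace_def L2_zero L2_add L2_cscale)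

lemma char_fun_L2: "char_fun s k \<in> L2 s"
  by (rule L2_bounded[where B = 1]) (auto simp: char_fun_measurable)

lemma borel_measurable_cnj [measurable]: "cnj \<in> borel_measurable borel"
  by (intro borel_measurable_continuous_onI continuous_intros)

lemma L2_inner_integrable:
  assumes "f \<in> L2 s" "g \<in> L2 s"
  shows "integrable (torus s) (\<lambda>x. f x * cnj (g x))"
proof -
  have m [measurable]: "f \<in> borel_measurable (torus s)" "g \<in> borel_measurable (torus s)"
    using assms by (auto simp: L2_def)
  have bd: "cmod (f x * cnj (g x)) \<le> (cmod (f x))\<^sup>2 + (cmod (g x))\<^sup>2" for x
  proof -
    have "0 \<le> cmod (f x) * cmod (g x)" by simp
    moreover have "2 * (cmod (f x) * cmod (g x)) \<le> (cmod (f x))\<^sup>2 + (cmod (g x))\<^sup>2"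
      using sum_squares_bound[of "cmod (f x)" "cmod (g x)"] by (simp only: mult.assoc)
    ultimately show ?thesis unfolding norm_mult complex_mod_cnj by linarith
  qed
  show ?thesis
    by (rule Bochner_Integration.integrable_bound
        [where f = "\<lambda>x. (cmod (f x))\<^sup>2 + (cmod (g x))\<^sup>2"])
       (use assms bd in \<open>auto simp: L2_integrable\<close>)
qed

lemma L2_inner_add_left:
  "f \<in> L2 s \<Longrightarrow> g \<in> L2 s \<Longrightarrow> h \<in> L2 s \<Longrightarrow> L2_inner s (f + g) h = L2_inner s f h + L2_inner s g h"
  by (simp add: L2_inner_def distrib_right L2_inner_integrable add_divide_distrib)

lemma L2_inner_diff_left:
  "f \<in> L2 s \<Longrightarrow> g \<in> L2 s \<Longrightarrow> h \<in> L2 s \<Longrightarrow> L2_inner s (f - g) h = L2_inner s f h - L2_inner s g h"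
  by (simp add: L2_inner_def left_diff_distrib L2_inner_integrable diff_divide_distrib)

lemma L2_inner_cscale_left: "L2_inner s (cscale c f) h = c * L2_inner s f h"
  by (simp add: L2_inner_def cscale_def mult.assoc)

lemma cnj_L2_inner: "cnj (L2_inner s f g) = L2_inner s g f"
  unfolding L2_inner_def complex_cnj_divide Bochner_Integration.integral_cnj[symmetric]
  by (simp only: complex_cnj_mult complex_cnj_cnj complex_cnj_complex_of_real mult.commute)

lemma L2_inner_sum_left:
  "(\<And>i. i \<in> A \<Longrightarrow> f i \<in> L2 s) \<Longrightarrow> h \<in> L2 s \<Longrightarrow>
    L2_inner s (\<Sum>i\<in>A. f i) h = (\<Sum>i\<in>A. L2_inner s (f i) h)"
  by (induction A rule: infinite_finite_induct)
     (auto simp: L2_inner_add_left L2_sum, auto simp: L2_inner_def)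

lemma L2_inner_self: "L2_inner s f f = complex_of_real ((LINT x|torus s. (cmod (f x))\<^sup>2) / (2 * pi) ^ s)"
  by (simp only: L2_inner_def complex_norm_square[symmetric] integral_complex_of_real of_real_divide)

lemma L2_norm_sq: "(L2_norm s f)\<^sup>2 = (LINT x|torus s. (cmod (f x))\<^sup>2) / (2 * pi) ^ s"
  by (simp add: L2_norm_def L2_inner_self)

lemma L2_norm_nonneg [simp]: "0 \<le> L2_norm s f"
  by (simp add: L2_norm_def L2_inner_self)

lemma L2_inner_self': "L2_inner s f f = complex_of_real ((L2_norm s f)\<^sup>2)"
  by (simp add: L2_inner_self L2_norm_sq)

lemma L2_norm_cscale: "L2_norm s (cscale c f) = cmod c * L2_norm s f"
proof -
  have "(L2_norm s (cscale c f))\<^sup>2 = (cmod c * L2_norm s f)\<^sup>2"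
    by (simp add: L2_norm_sq cscale_def norm_mult power_mult_distrib)
  then show ?thesis by (simp add: power2_eq_iff_nonneg)
qed

lemma L2_norm_diff_sq:
  assumes "f \<in> L2 s" "g \<in> L2 s"
  shows "(L2_norm s (f - g))\<^sup>2 = (L2_norm s f)\<^sup>2 + (L2_norm s g)\<^sup>2 - 2 * Re (L2_inner s f g)"
proof -
  have d: "f - g \<in> L2 s" using assms by (rule L2_diff)
  have "L2_inner s (f - g) (f - g) = L2_inner s f (f - g) - L2_inner s g (f - g)"
    using assms d by (simp add: L2_inner_diff_left)
  also have "\<dots> = cnj (L2_inner s (f - g) f) - cnj (L2_inner s (f - g) g)"
    by (simp only: cnj_L2_inner)
  also have "\<dots> = L2_inner s f f - L2_inner s f g - L2_inner s g f + L2_inner s g g"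
    using assms by (simp add: L2_inner_diff_left cnj_L2_inner)
  finally have "Re (L2_inner s (f - g) (f - g))
      = Re (L2_inner s f f - L2_inner s f g - L2_inner s g f + L2_inner s g g)" by simp
  moreover have "Re (L2_inner s g f) = Re (L2_inner s f g)"
    by (subst cnj_L2_inner[symmetric]) simp
  ultimately show ?thesis by (simp add: L2_inner_self')
qed

text \<open>This stands in for the triangle inequality. It follows pointwise from
  \<open>norm_add_sq_le\<close>, and its factor 2 is the source of the tolerances
  \<open>e / 4\<close> below.\<close>

lemma L2_norm_diff_sq_le:
  assumes "f \<in> L2 s" "g \<in> L2 s" "h \<in> L2 s"
  shows "(L2_norm s (f - h))\<^sup>2 \<le> 2 * (L2_norm s (f - g))\<^sup>2 + 2 * (L2_norm s (g - h))\<^sup>2"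
proof -
  have i: "integrable (torus s) (\<lambda>x. (cmod (f x - g x))\<^sup>2)" "integrable (torus s) (\<lambda>x. (cmod (g x - h x))\<^sup>2)"
    "integrable (torus s) (\<lambda>x. (cmod (f x - h x))\<^sup>2)"
    using L2_integrable[OF L2_diff[OF assms(1,2)]] L2_integrable[OF L2_diff[OF assms(2,3)]]
      L2_integrable[OF L2_diff[OF assms(1,3)]] by simp_all
  have "(LINT x|torus s. (cmod (f x - h x))\<^sup>2)
      \<le> (LINT x|torus s. 2 * (cmod (f x - g x))\<^sup>2 + 2 * (cmod (g x - h x))\<^sup>2)"
    using i norm_add_sq_le[of "f x - g x" "g x - h x" for x] by (intro integral_mono) auto
  also have "\<dots> = 2 * (LINT x|torus s. (cmod (f x - g x))\<^sup>2) + 2 * (LINT x|torus s. (cmod (g x - h x))\<^sup>2)"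
    using i by simp
  finally show ?thesis
    by (simp add: L2_norm_sq divide_simps)
qed

abbreviation trig_sum :: "nat \<Rightarrow> (nat \<Rightarrow> int) set \<Rightarrow> ((nat \<Rightarrow> int) \<Rightarrow> complex) \<Rightarrow> (nat \<Rightarrow> real) \<Rightarrow> complex" where
  "trig_sum s G c \<equiv> \<Sum>k\<in>G. cscale (c k) (char_fun s k)"

lemma trig_sum_L2: "trig_sum s G c \<in> L2 s"
  by (intro L2_sum L2_cscale char_fun_L2)

lemma L2_inner_trig_sum:
  assumes "f \<in> L2 s"
  shows "L2_inner s f (trig_sum s G c) = (\<Sum>k\<in>G. fourier_coeff s f k * cnj (c k))"
proof -
  have "L2_inner s f (trig_sum s G c) = cnj (L2_inner s (trig_sum s G c) f)"
    by (simp only: cnj_L2_inner)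
  also have "\<dots> = (\<Sum>k\<in>G. cnj (c k) * L2_inner s f (char_fun s k))"
    using assms
    by (simp add: L2_inner_sum_left L2_cscale char_fun_L2 L2_inner_cscale_left cnj_L2_inner)
  finally show ?thesis by (simp add: fourier_coeff_def mult.commute)
qed

lemma fourier_coeff_trig_sum:
  assumes "finite G" "G \<subseteq> freqs s" "k \<in> freqs s"
  shows "fourier_coeff s (trig_sum s G c) k = (if k \<in> G then c k else 0)"
proof -
  have "fourier_coeff s (trig_sum s G c) k = (\<Sum>l\<in>G. c l * L2_inner s (char_fun s l) (char_fun s k))"
    by (simp add: fourier_coeff_def L2_inner_sum_left L2_cscale char_fun_L2 L2_inner_cscale_left)
  also have "\<dots> = (\<Sum>l\<in>G. if l = k then c l else 0)"
    using assms by (intro sum.cong refl) (auto simp: L2_inner_char_fun)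
  finally show ?thesis using assms by simp
qed

lemma L2_norm_trig_sum:
  assumes "finite G" "G \<subseteq> freqs s"
  shows "(L2_norm s (trig_sum s G c))\<^sup>2 = (\<Sum>k\<in>G. (cmod (c k))\<^sup>2)"
proof -
  have "complex_of_real ((L2_norm s (trig_sum s G c))\<^sup>2) = (\<Sum>k\<in>G. c k * cnj (c k))"
    unfolding L2_inner_self'[symmetric] L2_inner_trig_sum[OF trig_sum_L2]
    using assms by (intro sum.cong refl) (simp add: fourier_coeff_trig_sum subsetD)
  also have "\<dots> = complex_of_real (\<Sum>k\<in>G. (cmod (c k))\<^sup>2)"
    by (simp add: complex_norm_square[symmetric])
  finally show ?thesis by (simp only: of_real_eq_iff)
qed

text \<open>This is completing the square in each coefficient. Taking for \<open>c\<close> the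
  Fourier coefficients gives Bessel's inequality; for arbitrary \<open>c\<close> the last sum is
  nonnegative, so the error of any trigonometric sum over \<open>G\<close> bounds the Bessel defect
  on \<open>G\<close> from above.\<close>

lemma L2_norm_diff_trig_sum:
  assumes "f \<in> L2 s" "finite G" "G \<subseteq> freqs s"
  shows "(L2_norm s (f - trig_sum s G c))\<^sup>2 = (L2_norm s f)\<^sup>2
    - (\<Sum>k\<in>G. (cmod (fourier_coeff s f k))\<^sup>2) + (\<Sum>k\<in>G. (cmod (fourier_coeff s f k - c k))\<^sup>2)"
proof -
  have eq: "(cmod (c k))\<^sup>2 - 2 * Re (fourier_coeff s f k * cnj (c k))
    = (cmod (fourier_coeff s f k - c k))\<^sup>2 - (cmod (fourier_coeff s f k))\<^sup>2" for k
    unfolding cmod_power2 by (simp add: power2_eq_square algebra_simps)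
  have "(L2_norm s (f - trig_sum s G c))\<^sup>2
      = (L2_norm s f)\<^sup>2 + (\<Sum>k\<in>G. (cmod (c k))\<^sup>2 - 2 * Re (fourier_coeff s f k * cnj (c k)))"
    using assms
    by (simp add: L2_norm_diff_sq trig_sum_L2 L2_inner_trig_sum L2_norm_trig_sum sum_subtractf sum_distrib_left)
  then show ?thesis unfolding eq by (simp add: sum_subtractf)
qed

lemma bessel:
  assumes "f \<in> L2 s" "finite G" "G \<subseteq> freqs s"
  shows "(\<Sum>k\<in>G. (cmod (fourier_coeff s f k))\<^sup>2) \<le> (L2_norm s f)\<^sup>2"
  using L2_norm_diff_trig_sum[OF assms, of "fourier_coeff s f"]
    zero_le_power2[of "L2_norm s (f - trig_sum s G (fourier_coeff s f))"] by simp

subsection \<open>The closure of the trigonometric polynomials\<close>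

definition trig_polys :: "nat \<Rightarrow> ((nat \<Rightarrow> real) \<Rightarrow> complex) set" where
  "trig_polys s = cfun.span (range (char_fun s))"

lemma trig_polys_L2: "trig_polys s \<subseteq> L2 s"
  unfolding trig_polys_def
  by (intro cfun.span_minimal L2_subspace) (auto simp: char_fun_L2)

lemma trig_polys_add: "p \<in> trig_polys s \<Longrightarrow> q \<in> trig_polys s \<Longrightarrow> p + q \<in> trig_polys s"
  unfolding trig_polys_def by (rule cfun.span_add)

lemma trig_polys_cscale: "p \<in> trig_polys s \<Longrightarrow> cscale c p \<in> trig_polys s"
  unfolding trig_polys_def by (rule cfun.span_scale)

lemma char_fun_trig_polys: "char_fun s k \<in> trig_polys s"
  unfolding trig_polys_def by (intro cfun.span_base) auto

lemma trig_polys_bounded: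
  assumes "p \<in> trig_polys s"
  shows "\<exists>B. \<forall>x. cmod (p x) \<le> B"
  using assms unfolding trig_polys_def
proof (induction rule: cfun.span_induct_alt)
  case base
  then show ?case by auto
next
  case (step c p q)
  then obtain B k where "\<And>x. cmod (q x) \<le> B" "p = char_fun s k" by auto
  then have "cmod ((cscale c p + q) x) \<le> cmod c + B" for x
    by (auto simp: cscale_def norm_mult intro!: norm_triangle_le add_mono)
  then show ?case by blast
qed

lemma trig_polys_mult:
  assumes "p \<in> trig_polys s" and "q \<in> trig_polys s"
  shows "(\<lambda>x. p x * q x) \<in> trig_polys s"
proof -
  have *: "(\<lambda>x. char_fun s k x * q x) \<in> trig_polys s" for k
    using assms(2) unfolding trig_polys_def
  proof (induction rule: cfun.span_induct_alt)
    case base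
    then show ?case using cfun.span_zero by (simp add: zero_fun_def)
  next
    case (step c p q)
    then obtain l where l: "p = char_fun s l" by auto
    have "(\<lambda>x. char_fun s k x * (cscale c p + q) x)
      = cscale c (char_fun s (\<lambda>j. k j + l j)) + (\<lambda>x. char_fun s k x * q x)"
      by (auto simp: fun_eq_iff l cscale_def algebra_simps simp flip: char_fun_mult)
    with step show ?case
      by (auto intro!: cfun.span_add cfun.span_scale intro: cfun.span_base)
  qed
  show ?thesis
    using assms(1) unfolding trig_polys_def
  proof (induction rule: cfun.span_induct_alt)
    case base
    then show ?case using cfun.span_zero by (simp add: zero_fun_def)
  next
    case (step c p p')
    then obtain l where l: "p = char_fun s l" by auto
    have "(\<lambda>x. (cscale c p + p') x * q x)
      = cscale c (\<lambda>x. char_fun s l x * q x) + (\<lambda>x. p' x * q x)"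
      by (auto simp: fun_eq_iff l cscale_def algebra_simps)
    with step *[of l] show ?case
      unfolding trig_polys_def by (auto intro!: cfun.span_add cfun.span_scale)
  qed
qed

definition trig_closure :: "nat \<Rightarrow> ((nat \<Rightarrow> real) \<Rightarrow> complex) set" where
  "trig_closure s = {f \<in> L2 s. \<forall>e>0. \<exists>p\<in>trig_polys s. (L2_norm s (f - p))\<^sup>2 < e}"

lemma trig_closure_closed:
  assumes "f \<in> L2 s" and "\<And>e. e > 0 \<Longrightarrow> \<exists>g\<in>trig_closure s. (L2_norm s (f - g))\<^sup>2 < e"
  shows "f \<in> trig_closure s"
  unfolding trig_closure_def
proof safe
  fix e :: real assume "e > 0"
  obtain g where g: "g \<in> trig_closure s" "(L2_norm s (f - g))\<^sup>2 < e / 4"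
    using assms(2)[of "e / 4"] \<open>e > 0\<close> by auto
  obtain p where p: "p \<in> trig_polys s" "(L2_norm s (g - p))\<^sup>2 < e / 4"
    using g(1) \<open>e > 0\<close> unfolding trig_closure_def by (auto dest: spec[of _ "e / 4"])
  have "(L2_norm s (f - p))\<^sup>2 \<le> 2 * (L2_norm s (f - g))\<^sup>2 + 2 * (L2_norm s (g - p))\<^sup>2"
    using assms(1) g(1) p(1) trig_polys_L2 by (intro L2_norm_diff_sq_le) (auto simp: trig_closure_def)
  with g p show "\<exists>p\<in>trig_polys s. (L2_norm s (f - p))\<^sup>2 < e" by force
qed fact

lemma L2_norm_zero [simp]: "L2_norm s 0 = 0"
  by (simp add: L2_norm_def L2_inner_def)

lemma trig_polys_closure: "p \<in> trig_polys s \<Longrightarrow> p \<in> trig_closure s"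
  using trig_polys_L2[of s] by (auto simp: trig_closure_def intro!: bexI[of _ p])

lemma trig_closure_L2: "f \<in> trig_closure s \<Longrightarrow> f \<in> L2 s"
  by (simp add: trig_closure_def)

lemma trig_closure_approx:
  assumes "f \<in> trig_closure s" "e > 0"
  obtains p where "p \<in> trig_polys s" "p \<in> L2 s" "(L2_norm s (f - p))\<^sup>2 < e"
  using assms trig_polys_L2[of s] unfolding trig_closure_def by blast

lemma trig_closure_add:
  assumes "f \<in> trig_closure s" "g \<in> trig_closure s"
  shows "f + g \<in> trig_closure s"
proof (rule trig_closure_closed)
  have L: "f \<in> L2 s" "g \<in> L2 s" using assms by (auto simp: trig_closure_L2)
  then show "f + g \<in> L2 s" by (rule L2_add)
  fix e :: real assume e: "e > 0"
  obtain p where p: "p \<in> trig_polys s" "p \<in> L2 s" "(L2_norm s (f - p))\<^sup>2 < e / 4"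
    using trig_closure_approx[OF assms(1), of "e / 4"] e by auto
  obtain q where q: "q \<in> trig_polys s" "q \<in> L2 s" "(L2_norm s (g - q))\<^sup>2 < e / 4"
    using trig_closure_approx[OF assms(2), of "e / 4"] e by auto
  have "(L2_norm s ((f + g) - (p + q)))\<^sup>2
      \<le> 2 * (L2_norm s ((f + g) - (p + g)))\<^sup>2 + 2 * (L2_norm s ((p + g) - (p + q)))\<^sup>2"
    using L p q by (intro L2_norm_diff_sq_le L2_add)
  also have "\<dots> = 2 * (L2_norm s (f - p))\<^sup>2 + 2 * (L2_norm s (g - q))\<^sup>2" by simp
  also have "\<dots> < e" using p q by simp
  finally show "\<exists>h\<in>trig_closure s. (L2_norm s ((f + g) - h))\<^sup>2 < e"
    using trig_polys_closure[OF trig_polys_add[OF p(1) q(1)]] by blast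
qed

lemma trig_closure_cscale:
  assumes "f \<in> trig_closure s"
  shows "cscale c f \<in> trig_closure s"
proof (rule trig_closure_closed)
  show "cscale c f \<in> L2 s" using assms by (intro L2_cscale trig_closure_L2)
  fix e :: real assume e: "e > 0"
  \<comment> \<open>The summand 1 keeps the tolerance below well defined when \<open>c\<close> is
    0.\<close>
  have pos: "(cmod c)\<^sup>2 + 1 > 0" by (simp add: add_nonneg_pos)
  obtain p where p: "p \<in> trig_polys s" "(L2_norm s (f - p))\<^sup>2 < e / ((cmod c)\<^sup>2 + 1)"
    using trig_closure_approx[OF assms, of "e / ((cmod c)\<^sup>2 + 1)"] e pos by auto
  have "cscale c f - cscale c p = cscale c (f - p)" by (simp add: cfun.scale_right_diff_distrib)
  then have "(L2_norm s (cscale c f - cscale c p))\<^sup>2 = (cmod c)\<^sup>2 * (L2_norm s (f - p))\<^sup>2"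
    by (simp add: L2_norm_cscale power_mult_distrib)
  also have "\<dots> \<le> ((cmod c)\<^sup>2 + 1) * (L2_norm s (f - p))\<^sup>2" by (simp add: mult_right_mono)
  also have "\<dots> < e" using p(2) pos by (simp add: pos_less_divide_eq mult.commute)
  finally show "\<exists>h\<in>trig_closure s. (L2_norm s (cscale c f - h))\<^sup>2 < e"
    using trig_polys_closure[OF trig_polys_cscale[OF p(1)]] by blast
qed

lemma trig_closure_zero: "0 \<in> trig_closure s"
  using trig_polys_closure[of 0] by (simp add: trig_polys_def cfun.span_zero)

lemma trig_closure_sum:
  "(\<And>i. i \<in> A \<Longrightarrow> f i \<in> trig_closure s) \<Longrightarrow> (\<Sum>i\<in>A. f i) \<in> trig_closure s"
  by (induction A rule: infinite_finite_induct) (auto intro: trig_closure_add trig_closure_zero)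

lemma trig_closure_const: "(\<lambda>_. c) \<in> trig_closure s"
proof -
  have "(\<lambda>_. c) = cscale c (char_fun s (\<lambda>_. 0))" by (simp add: char_fun_def cscale_def)
  then show ?thesis by (simp add: trig_closure_cscale trig_polys_closure char_fun_trig_polys)
qed

section \<open>Products and limits in the closure\<close>

lemma L2_norm_mult_le:
  assumes "f \<in> L2 s" "u \<in> borel_measurable (torus s)" and B: "\<And>x. x \<in> space (torus s) \<Longrightarrow> cmod (u x) \<le> B"
  shows "(\<lambda>x. u x * f x) \<in> L2 s"
    and "(L2_norm s (\<lambda>x. u x * f x))\<^sup>2 \<le> B\<^sup>2 * (L2_norm s f)\<^sup>2"
proof -
  have m [measurable]: "f \<in> borel_measurable (torus s)" "u \<in> borel_measurable (torus s)"
    using assms by (auto simp: L2_def)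
  have i: "integrable (torus s) (\<lambda>x. B\<^sup>2 * (cmod (f x))\<^sup>2)" using assms by (simp add: L2_integrable)
  have le: "(cmod (u x * f x))\<^sup>2 \<le> B\<^sup>2 * (cmod (f x))\<^sup>2" if "x \<in> space (torus s)" for x
    using power_mono[OF B[OF that] norm_ge_zero, of 2]
    by (simp add: norm_mult power_mult_distrib mult_right_mono)
  have i2: "integrable (torus s) (\<lambda>x. (cmod (u x * f x))\<^sup>2)"
    by (rule Bochner_Integration.integrable_bound[OF i]) (use le in auto)
  then show "(\<lambda>x. u x * f x) \<in> L2 s" by (simp add: L2_def)
  have "(LINT x|torus s. (cmod (u x * f x))\<^sup>2) \<le> (LINT x|torus s. B\<^sup>2 * (cmod (f x))\<^sup>2)"
    using i i2 le by (intro integral_mono) auto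
  then show "(L2_norm s (\<lambda>x. u x * f x))\<^sup>2 \<le> B\<^sup>2 * (L2_norm s f)\<^sup>2"
    by (simp add: L2_norm_sq divide_simps)
qed

text \<open>The approximation of g has to be chosen before that of f, because the error of the latter is
  multiplied by a bound for the former.\<close>

lemma trig_closure_mult:
  assumes f: "f \<in> trig_closure s" and g: "g \<in> trig_closure s"
    and B: "\<And>x. x \<in> space (torus s) \<Longrightarrow> cmod (f x) \<le> B"
  shows "(\<lambda>x. f x * g x) \<in> trig_closure s"
proof (rule trig_closure_closed)
  have L: "f \<in> L2 s" "g \<in> L2 s" using f g by (auto simp: trig_closure_L2)
  note fm = L2_measurable[OF L(1)]
  show fg: "(\<lambda>x. f x * g x) \<in> L2 s" using L2_norm_mult_le(1)[OF L(2) fm B] by simp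
  fix e :: real assume e: "e > 0"
  have small: "\<exists>d>0. c * d < e / 4" for c :: real
    using e by (intro exI[of _ "e / (8 * (\<bar>c\<bar> + 1))"]) (auto simp: field_simps abs_if add_pos_nonneg)
  obtain d where d: "d > 0" "B\<^sup>2 * d < e / 4" using small by blast
  obtain q where q: "q \<in> trig_polys s" "q \<in> L2 s" "(L2_norm s (g - q))\<^sup>2 < d"
    using trig_closure_approx[OF g d(1)] by auto
  obtain C where C: "\<And>x. cmod (q x) \<le> C" using trig_polys_bounded[OF q(1)] by auto
  obtain d' where d': "d' > 0" "C\<^sup>2 * d' < e / 4" using small by blast
  obtain p where p: "p \<in> trig_polys s" "p \<in> L2 s" "(L2_norm s (f - p))\<^sup>2 < d'"
    using trig_closure_approx[OF f d'(1)] by auto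
  note qm = L2_measurable[OF q(2)]
  \<comment> \<open>With f q as the intermediate function, the error of \<open>q\<close> is
    multiplied only by the bound for f, and the error of \<open>p\<close> only by the bound for
    \<open>q\<close>; thus g itself may be unbounded.\<close>
  have "(L2_norm s ((\<lambda>x. f x * g x) - (\<lambda>x. q x * p x)))\<^sup>2
      \<le> 2 * (L2_norm s ((\<lambda>x. f x * g x) - (\<lambda>x. f x * q x)))\<^sup>2
        + 2 * (L2_norm s ((\<lambda>x. f x * q x) - (\<lambda>x. q x * p x)))\<^sup>2"
    using L2_norm_mult_le(1)[OF q(2) fm B] L2_norm_mult_le(1)[OF p(2) qm C] fg
    by (intro L2_norm_diff_sq_le) auto
  also have "(\<lambda>x. f x * g x) - (\<lambda>x. f x * q x) = (\<lambda>x. f x * (g - q) x)"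
    by (simp add: fun_eq_iff algebra_simps)
  also have "(\<lambda>x. f x * q x) - (\<lambda>x. q x * p x) = (\<lambda>x. q x * (f - p) x)"
    by (simp add: fun_eq_iff algebra_simps)
  also have "2 * (L2_norm s (\<lambda>x. f x * (g - q) x))\<^sup>2 + 2 * (L2_norm s (\<lambda>x. q x * (f - p) x))\<^sup>2
      \<le> 2 * (B\<^sup>2 * d) + 2 * (C\<^sup>2 * d')"
  proof -
    have "(L2_norm s (\<lambda>x. f x * (g - q) x))\<^sup>2 \<le> B\<^sup>2 * (L2_norm s (g - q))\<^sup>2"
      by (rule L2_norm_mult_le(2)[OF L2_diff[OF L(2) q(2)] fm B])
    moreover have "(L2_norm s (\<lambda>x. q x * (f - p) x))\<^sup>2 \<le> C\<^sup>2 * (L2_norm s (f - p))\<^sup>2"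
      by (rule L2_norm_mult_le(2)[OF L2_diff[OF L(1) p(2)] qm C])
    moreover have "B\<^sup>2 * (L2_norm s (g - q))\<^sup>2 \<le> B\<^sup>2 * d" "C\<^sup>2 * (L2_norm s (f - p))\<^sup>2 \<le> C\<^sup>2 * d'"
      using p q by (auto intro!: mult_left_mono)
    ultimately show ?thesis by linarith
  qed
  also have "\<dots> < e" using d d' by linarith
  finally show "\<exists>h\<in>trig_closure s. (L2_norm s ((\<lambda>x. f x * g x) - h))\<^sup>2 < e"
    using trig_polys_closure[OF trig_polys_mult[OF q(1) p(1)]] by blast
qed

text \<open>Functions that agree almost everywhere have distance 0. Besides removing null sets, this
  removes the influence of values outside \<open>space (torus s)\<close>.\<close>

lemma trig_closure_AE:
  assumes f: "f \<in> trig_closure s" and m: "g \<in> borel_measurable (torus s)" and "AE x in torus s. g x = f x"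
  shows "g \<in> trig_closure s"
proof (rule trig_closure_closed)
  have L: "f \<in> L2 s" using f by (rule trig_closure_L2)
  note [measurable] = m L2_measurable[OF L]
  have "integrable (torus s) (\<lambda>x. (cmod (g x))\<^sup>2) \<longleftrightarrow> integrable (torus s) (\<lambda>x. (cmod (f x))\<^sup>2)"
    using assms(3) by (intro integrable_cong_AE) auto
  then show "g \<in> L2 s" using L m by (simp add: L2_def)
  have "(LINT x|torus s. (cmod (g x - f x))\<^sup>2) = (LINT x|torus s. 0)"
    using assms(3) by (intro integral_cong_AE) auto
  then have "(L2_norm s (g - f))\<^sup>2 = 0" by (simp add: L2_norm_sq)
  then show "\<exists>h\<in>trig_closure s. (L2_norm s (g - h))\<^sup>2 < e" if "e > 0" for e
    using f that by (intro bexI[of _ f]) auto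
qed

text \<open>Dominated convergence is applied to the squared errors. The limit inherits the bound
  \<open>w\<close>, so these errors are at most 4 times the square of \<open>w\<close>, which is
  integrable.\<close>

lemma trig_closure_dominated:
  assumes F: "\<And>n. F n \<in> trig_closure s"
    and lim: "\<And>x. x \<in> space (torus s) \<Longrightarrow> (\<lambda>n. F n x) \<longlonglongrightarrow> f x"
    and w: "integrable (torus s) (\<lambda>x. (w x)\<^sup>2)"
    and bd: "\<And>n x. x \<in> space (torus s) \<Longrightarrow> cmod (F n x) \<le> w x"
  shows "f \<in> trig_closure s"
proof (rule trig_closure_closed)
  have Fm [measurable]: "F n \<in> borel_measurable (torus s)" for n
    using F by (intro L2_measurable trig_closure_L2)
  have fm [measurable]: "f \<in> borel_measurable (torus s)"
    by (rule borel_measurable_LIMSEQ_metric[OF Fm lim])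
  have fw: "cmod (f x) \<le> w x" if "x \<in> space (torus s)" for x
    using tendsto_norm[OF lim[OF that]] bd[OF that] by (intro LIMSEQ_le_const2) auto
  have w0: "0 \<le> w x" if "x \<in> space (torus s)" for x
    using order_trans[OF norm_ge_zero fw[OF that]] .
  have "integrable (torus s) (\<lambda>x. (cmod (f x))\<^sup>2)"
    by (rule Bochner_Integration.integrable_bound[OF w]) (use fw w0 in \<open>auto intro!: power_mono\<close>)
  then show L: "f \<in> L2 s" using fm by (simp add: L2_def)
  have "(\<lambda>n. LINT x|torus s. (cmod (f x - F n x))\<^sup>2) \<longlonglongrightarrow> (LINT x|torus s. 0)"
  proof (rule integral_dominated_convergence[where w = "\<lambda>x. 4 * (w x)\<^sup>2"])
    show "AE x in torus s. (\<lambda>n. (cmod (f x - F n x))\<^sup>2) \<longlonglongrightarrow> 0"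
    proof (rule AE_I2)
      fix x assume x: "x \<in> space (torus s)"
      have "(\<lambda>n. (cmod (f x - F n x))\<^sup>2) \<longlonglongrightarrow> (cmod (f x - f x))\<^sup>2"
        by (intro tendsto_intros lim[OF x])
      then show "(\<lambda>n. (cmod (f x - F n x))\<^sup>2) \<longlonglongrightarrow> 0" by simp
    qed
    show "AE x in torus s. norm ((cmod (f x - F n x))\<^sup>2) \<le> 4 * (w x)\<^sup>2" for n
    proof (rule AE_I2)
      fix x assume x: "x \<in> space (torus s)"
      have "cmod (f x - F n x) \<le> 2 * w x"
        using norm_triangle_ineq4[of "f x" "F n x"] fw[OF x] bd[OF x, of n] by linarith
      from power_mono[OF this norm_ge_zero, of 2]
      show "norm ((cmod (f x - F n x))\<^sup>2) \<le> 4 * (w x)\<^sup>2" by (simp add: power_mult_distrib)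
    qed
  qed (use w in auto)
  then have "(\<lambda>n. (L2_norm s (f - F n))\<^sup>2) \<longlonglongrightarrow> 0 / (2 * pi) ^ s"
    unfolding L2_norm_sq fun_diff_def by (intro tendsto_divide) auto
  then have "(\<lambda>n. (L2_norm s (f - F n))\<^sup>2) \<longlonglongrightarrow> 0" by simp
  then show "\<exists>g\<in>trig_closure s. (L2_norm s (f - g))\<^sup>2 < e" if "e > 0" for e
    using order_tendstoD(2)[OF _ that] F by (metis (mono_tags, lifting) eventually_sequentially order_refl)
qed

subsection \<open>Completeness of the trigonometric system\<close>

definition approximable_sets :: "nat \<Rightarrow> (nat \<Rightarrow> real) set set" where
  "approximable_sets s = {A \<in> sets (torus s). (\<lambda>x. indicator A x) \<in> trig_closure s}"

lemma approximable_sets_Compl: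
  assumes "A \<in> approximable_sets s"
  shows "space (torus s) - A \<in> approximable_sets s"
proof -
  have "(\<lambda>x. indicator (space (torus s) - A) x) \<in> trig_closure s"
  proof (rule trig_closure_AE)
    show "(\<lambda>_. 1) + cscale (-1) (\<lambda>x. indicator A x) \<in> trig_closure s"
      using assms by (intro trig_closure_add trig_closure_const trig_closure_cscale)
        (simp add: approximable_sets_def)
    show "(\<lambda>x. indicator (space (torus s) - A) x :: complex) \<in> borel_measurable (torus s)"
      using assms by (intro borel_measurable_indicator) (auto simp: approximable_sets_def)
  qed (auto simp: cscale_def indicator_def)
  then show ?thesis using assms by (auto simp: approximable_sets_def)
qed

text \<open>Indicators turn an intersection into a product, and being bounded by 1 they meet the
  boundedness condition of \<open>trig_closure_mult\<close>.\<close>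

lemma approximable_sets_Int:
  assumes "A \<in> approximable_sets s" "B \<in> approximable_sets s"
  shows "A \<inter> B \<in> approximable_sets s"
proof -
  have "(\<lambda>x. indicator A x * indicator B x) \<in> trig_closure s"
    using assms by (intro trig_closure_mult[where B = 1]) (auto simp: approximable_sets_def indicator_def)
  moreover have "(\<lambda>x. indicator A x * indicator B x) = (\<lambda>x. indicator (A \<inter> B) x :: complex)"
    by (auto simp: indicator_def)
  ultimately show ?thesis using assms by (auto simp: approximable_sets_def)
qed

lemma approximable_sets_empty: "{} \<in> approximable_sets s"
proof -
  have "indicator {} = (\<lambda>_::nat \<Rightarrow> real. 0::complex)" by (simp add: fun_eq_iff)
  then show ?thesis using trig_closure_const[of 0 s] by (simp add: approximable_sets_def)
qed

lemma approximable_sets_Un: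
  assumes "A \<in> approximable_sets s" "B \<in> approximable_sets s"
  shows "A \<union> B \<in> approximable_sets s"
proof -
  have "A \<union> B = space (torus s) - ((space (torus s) - A) \<inter> (space (torus s) - B))"
    using assms sets.sets_into_space[of _ "torus s"] by (auto simp: approximable_sets_def)
  with assms show ?thesis by (simp add: approximable_sets_Compl approximable_sets_Int)
qed

text \<open>The indicators of the finite unions converge pointwise to that of the whole union, and
  the constant 1 dominates them on a finite measure space.\<close>

lemma approximable_sets_UN:
  assumes "\<And>i::nat. A i \<in> approximable_sets s"
  shows "(\<Union>i. A i) \<in> approximable_sets s"
proof -
  have fin: "(\<Union>i<n. A i) \<in> approximable_sets s" for n
    by (induction n) (auto simp: lessThan_Suc approximable_sets_empty intro!: approximable_sets_Un assms)
  interpret finite_measure "torus s" by (rule finite_measure_torus)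
  have "(\<lambda>x. indicator (\<Union>i. A i) x) \<in> trig_closure s"
  proof (rule trig_closure_dominated[where w = "\<lambda>_. 1"])
    show "(\<lambda>x. indicator (\<Union>i<n. A i) x) \<in> trig_closure s" for n
      using fin[of n] by (simp add: approximable_sets_def)
    show "(\<lambda>n. indicator (\<Union>i<n. A i) x) \<longlonglongrightarrow> (indicator (\<Union>i. A i) x :: complex)" for x
      by (rule LIMSEQ_indicator_UN)
  qed (auto simp: indicator_def)
  moreover have "(\<Union>i. A i) \<in> sets (torus s)"
    using assms by (intro sets.countable_UN) (auto simp: approximable_sets_def)
  ultimately show ?thesis by (simp add: approximable_sets_def)
qed

lemma sigma_algebra_approximable_sets:
  "sigma_algebra (space (torus s)) (approximable_sets s)"
  unfolding sigma_algebra_iff2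
proof (intro conjI ballI allI impI)
  show "approximable_sets s \<subseteq> Pow (space (torus s))"
    using sets.space_closed[of "torus s"] by (auto simp: approximable_sets_def)
  show "(\<Union>i. A i) \<in> approximable_sets s" if "range A \<subseteq> approximable_sets s" for A :: "nat \<Rightarrow> _"
    using that by (intro approximable_sets_UN) auto
qed (simp_all add: approximable_sets_Compl approximable_sets_empty)

text \<open>Packaging the sigma-algebra as a measure space makes Borel measurability with respect to
  it available, and with it the closure of measurable functions under products and
  compositions.\<close>

definition approximable_algebra :: "nat \<Rightarrow> (nat \<Rightarrow> real) measure" where
  "approximable_algebra s = sigma (space (torus s)) (approximable_sets s)"

lemma space_approximable_algebra [simp]: "space (approximable_algebra s) = space (torus s)"
  unfolding approximable_algebra_def
  by (rule space_measure_of) (use sets.space_closed[of "torus s"] in \<open>auto simp: approximable_sets_def\<close>)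

lemma sets_approximable_algebra [simp]: "sets (approximable_algebra s) = approximable_sets s"
  unfolding approximable_algebra_def
  by (rule sigma_algebra.sets_measure_of_eq[OF sigma_algebra_approximable_sets])

section \<open>Functions of a bounded approximable function: polynomial, continuous,
  indicator\<close>

lemma trig_closure_polynomial:
  assumes "real_polynomial_function g" and u: "(\<lambda>x. complex_of_real (u x)) \<in> trig_closure s"
    and B: "\<And>x. x \<in> space (torus s) \<Longrightarrow> \<bar>u x\<bar> \<le> B"
  shows "(\<lambda>x. complex_of_real (g (u x))) \<in> trig_closure s"
  using assms(1)
proof (induction rule: real_polynomial_function.induct)
  case (linear f)
  then obtain c where "f = (\<lambda>x. x * c)" using real_bounded_linear by auto
  then have "(\<lambda>x. complex_of_real (f (u x))) = cscale c (\<lambda>x. complex_of_real (u x))"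
    by (simp add: cscale_def mult.commute)
  then show ?case using u by (simp add: trig_closure_cscale)
next
  case (const c)
  then show ?case by (rule trig_closure_const)
next
  case (add f g)
  then show ?case using trig_closure_add[OF add.IH] by (simp add: plus_fun_def)
next
  case (mult f g)
  \<comment> \<open>The product rule for the closure requires a bounded factor; \<open>f\<close> is
    continuous on a compact interval that contains all values of \<open>u\<close>.\<close>
  have "compact {-B..B}" by simp
  moreover have "continuous_on {-B..B} f"
    using mult.hyps(1) by (intro continuous_on_polymonial_function) (simp only: real_polynomial_function_eq)
  ultimately have "bounded (f ` {-B..B})"
    by (intro compact_imp_bounded compact_continuous_image)
  then obtain C where C: "\<bar>f t\<bar> \<le> C" if "t \<in> {-B..B}" for t
    unfolding bounded_iff real_norm_def by blast
  have "(\<lambda>x. complex_of_real (f (u x)) * complex_of_real (g (u x))) \<in> trig_closure s"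
  proof (rule trig_closure_mult[OF mult.IH])
    show "cmod (complex_of_real (f (u x))) \<le> C" if "x \<in> space (torus s)" for x
      using C[of "u x"] B[OF that] by (simp add: abs_le_iff)
  qed
  then show ?case by simp
qed

text \<open>Weierstrass approximation on \<open>{-B..B}\<close>, where \<open>u\<close> takes its
  values, reduces the claim to polynomials in \<open>u\<close> and a uniform limit.\<close>

lemma trig_closure_continuous:
  assumes \<phi>: "continuous_on UNIV \<phi>" and u: "(\<lambda>x. complex_of_real (u x)) \<in> trig_closure s"
    and m [measurable]: "u \<in> borel_measurable (torus s)"
    and B: "\<And>x. x \<in> space (torus s) \<Longrightarrow> \<bar>u x\<bar> \<le> B"
  shows "(\<lambda>x. complex_of_real (\<phi> (u x))) \<in> trig_closure s"
proof -
  have "compact {-B..B}" "continuous_on {-B..B} \<phi>"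
    using \<phi> continuous_on_subset by auto
  then have "\<exists>g. real_polynomial_function g \<and> (\<forall>t\<in>{-B..B}. \<bar>\<phi> t - g t\<bar> < 1 / Suc n)" for n
    using Stone_Weierstrass_real_polynomial_function[of "{-B..B}" \<phi> "1 / Suc n"]
    by (metis of_nat_0_less_iff zero_less_Suc zero_less_divide_1_iff)
  then obtain g where g: "\<And>n. real_polynomial_function (g n)"
    "\<And>n t. t \<in> {-B..B} \<Longrightarrow> \<bar>\<phi> t - g n t\<bar> < 1 / Suc n" by metis
  have uB: "u x \<in> {-B..B}" if "x \<in> space (torus s)" for x using B[OF that] by auto
  have "bounded (\<phi> ` {-B..B})"
    using \<phi> continuous_on_subset by (intro compact_imp_bounded compact_continuous_image) auto
  then obtain C where C: "\<bar>\<phi> t\<bar> \<le> C" if "t \<in> {-B..B}" for t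
    unfolding bounded_iff real_norm_def by blast
  interpret finite_measure "torus s" by (rule finite_measure_torus)
  show ?thesis
  \<comment> \<open>The polynomials differ from \<phi> by less than 1 on the interval, whence the 1
    added to the bound \<open>C\<close> of \<phi>.\<close>
  proof (rule trig_closure_dominated[where w = "\<lambda>_. C + 1"])
    show "(\<lambda>x. complex_of_real (g n (u x))) \<in> trig_closure s" for n
      using g(1) u B by (rule trig_closure_polynomial)
    fix x assume x: "x \<in> space (torus s)"
    have "(\<lambda>n. \<phi> (u x) - g n (u x)) \<longlonglongrightarrow> 0"
      using g(2)[OF uB[OF x]]
      by (intro Lim_null_comparison[OF _ LIMSEQ_inverse_real_of_nat])
         (auto intro!: always_eventually less_imp_le simp: inverse_eq_divide)
    from tendsto_diff[OF tendsto_const[of "\<phi> (u x)"] this]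
    show "(\<lambda>n. complex_of_real (g n (u x))) \<longlonglongrightarrow> complex_of_real (\<phi> (u x))"
      by (intro tendsto_of_real) simp
    show "cmod (complex_of_real (g n (u x))) \<le> C + 1" for n
    proof -
      have "1 / real (Suc n) \<le> 1" by simp
      then show ?thesis
        using g(2)[OF uB[OF x], of n] C[OF uB[OF x]] unfolding norm_of_real by linarith
    qed
  qed auto
qed

lemma trig_closure_measurable:
  assumes u: "(\<lambda>x. complex_of_real (u x)) \<in> trig_closure s"
    and m [measurable]: "u \<in> borel_measurable (torus s)"
    and B: "\<And>x. x \<in> space (torus s) \<Longrightarrow> \<bar>u x\<bar> \<le> B"
  shows "u \<in> borel_measurable (approximable_algebra s)"
  unfolding borel_measurable_iff_le
proof
  fix c :: real
  \<comment> \<open>For positive n this continuous ramp is 1 up to \<open>c\<close> and falls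
    linearly to 0 on the interval from \<open>c\<close> to \<open>c + 1 / n\<close>. The pointwise
    limit is the indicator of the sublevel set.\<close>
  define \<phi> where "\<phi> n t = max 0 (1 - real n * max 0 (t - c))" for n t
  interpret finite_measure "torus s" by (rule finite_measure_torus)
  let ?A = "{x \<in> space (torus s). u x \<le> c}"
  have "(\<lambda>x. indicator ?A x) \<in> trig_closure s"
  proof (rule trig_closure_dominated[where w = "\<lambda>_. 1"])
    show "(\<lambda>x. complex_of_real (\<phi> n (u x))) \<in> trig_closure s" for n
      by (rule trig_closure_continuous[OF _ u m B]) (auto simp: \<phi>_def intro!: continuous_intros)
    fix x assume x: "x \<in> space (torus s)"
    have "(\<lambda>n. \<phi> n (u x)) \<longlonglongrightarrow> indicator ?A x"
    proof (cases "u x \<le> c")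
      case True
      then show ?thesis using x by (simp add: \<phi>_def)
    next
      case False
      then obtain N where "real N * (u x - c) > 1" using reals_Archimedean3[of "u x - c"] by auto
      then have N: "real n * (u x - c) \<ge> 1" if "n \<ge> N" for n
        using that False mult_right_mono[of "real N" "real n" "u x - c"] by linarith
      have "eventually (\<lambda>n. \<phi> n (u x) = indicator ?A x) sequentially"
        unfolding eventually_sequentially
      proof (intro exI allI impI)
        fix n assume "N \<le> n"
        then show "\<phi> n (u x) = indicator ?A x"
          using False N[of n] by (simp add: \<phi>_def max_absorb1 max_absorb2)
      qed
      then show ?thesis by (rule tendsto_eventually)
    qed
    then have "(\<lambda>n. complex_of_real (\<phi> n (u x))) \<longlonglongrightarrow> complex_of_real (indicator ?A x)"
      by (rule tendsto_of_real)
    moreover have "complex_of_real (indicator ?A x) = indicator ?A x" by (simp add: indicator_def)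
    ultimately show "(\<lambda>n. complex_of_real (\<phi> n (u x))) \<longlonglongrightarrow> (indicator ?A x :: complex)"
      by (simp only:)
    show "cmod (complex_of_real (\<phi> n (u x))) \<le> 1" for n by (simp add: \<phi>_def)
  qed auto
  then show "{x \<in> space (approximable_algebra s). u x \<le> c} \<in> sets (approximable_algebra s)"
    by (simp add: approximable_sets_def)
qed

lemma cos_sin_approximable:
  assumes j: "j \<in> {1..s}"
  shows "(\<lambda>x. cos (x j)) \<in> borel_measurable (approximable_algebra s)"
    and "(\<lambda>x. sin (x j)) \<in> borel_measurable (approximable_algebra s)"
proof -
  \<comment> \<open>Frequency \<open>m\<close> in coordinate \<open>j\<close> and 0 elsewhere;
    Euler's formulas then express sine and cosine of \<open>x j\<close> with \<open>m\<close> equal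
    to 1 and -1.\<close>
  define k :: "int \<Rightarrow> nat \<Rightarrow> int" where "k m i = (if i = j then m else 0)" for m i
  have c: "char_fun s (k m) x = exp (\<i> * complex_of_real (of_int m * x j))" for m x
  proof -
    have "(\<Sum>i=1..s. of_int (k m i) * x i) = (\<Sum>i=1..s. if i = j then of_int m * x i else 0)"
      by (intro sum.cong) (auto simp: k_def)
    then show ?thesis using j by (simp add: char_fun_def)
  qed
  have "(\<lambda>x. complex_of_real (cos (x j))) = cscale (1/2) (char_fun s (k 1) + char_fun s (k (-1)))"
    unfolding cos_of_real[symmetric] cos_exp_eq by (simp add: fun_eq_iff cscale_def c)
  then have 1: "(\<lambda>x. complex_of_real (cos (x j))) \<in> trig_closure s"
    by (simp only:) (intro trig_closure_cscale trig_closure_add trig_polys_closure char_fun_trig_polys)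
  have "(\<lambda>x. complex_of_real (sin (x j)))
      = cscale (1 / (2 * \<i>)) (char_fun s (k 1) + cscale (-1) (char_fun s (k (-1))))"
    unfolding sin_of_real[symmetric] sin_exp_eq by (simp add: fun_eq_iff cscale_def c)
  then have 2: "(\<lambda>x. complex_of_real (sin (x j))) \<in> trig_closure s"
    by (simp only:) (intro trig_closure_cscale trig_closure_add trig_polys_closure char_fun_trig_polys)
  note [measurable] = coordinate_measurable[OF j]
  show "(\<lambda>x. cos (x j)) \<in> borel_measurable (approximable_algebra s)"
    "(\<lambda>x. sin (x j)) \<in> borel_measurable (approximable_algebra s)"
    by (rule trig_closure_measurable[OF 1 _, where B = 1]; simp)
       (rule trig_closure_measurable[OF 2 _, where B = 1]; simp)
qed

text \<open>On this interval \<open>arccos (cos x)\<close> is the absolute value of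
  \<open>x\<close>, and in its interior \<open>sin x\<close> has the sign of \<open>x\<close>. At
  the two endpoints the sine vanishes and the sign is lost.\<close>

lemma sgn_sin_arccos_cos:
  assumes "x \<in> {-pi..pi}" "x \<noteq> -pi" "x \<noteq> pi"
  shows "sgn (sin x) * arccos (cos x) = x"
proof -
  consider "x = 0" | "0 < x" | "x < 0" by linarith
  then show ?thesis
  proof cases
    case 2
    then show ?thesis using assms sin_gt_zero[of x] by (simp add: arccos_cos)
  next
    case 3
    then have "sin (-x) > 0" using assms by (intro sin_gt_zero) auto
    then show ?thesis using assms 3 by (simp add: arccos_cos2)
  qed simp
qed

text \<open>A coordinate is recovered from its sine and cosine except on the null set where it is
  \<^term>\<open>-pi\<close> or \<^term>\<open>pi\<close>.\<close>

lemma sets_torus_approximable: "sets (torus s) \<subseteq> approximable_sets s"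
proof -
  have gen: "{x \<in> space (torus s). x j \<in> A} \<in> approximable_sets s"
    if j: "j \<in> {1..s}" and A: "A \<in> sets borel" for j A
  proof -
    \<comment> \<open>Clamping to the interval from -1 to 1 does not change a cosine, but it makes
      the composition with \<open>arccos\<close> continuous on the whole line and hence Borel
      measurable.\<close>
    define y where "y x = sgn (sin (x j)) * arccos (max (-1) (min 1 (cos (x j))))" for x :: "nat \<Rightarrow> real"
    have "continuous_on UNIV (\<lambda>t. arccos (max (-1) (min 1 t)))"
      by (intro continuous_intros) auto
    note [measurable] = borel_measurable_continuous_onI[OF this]
    note [measurable] = cos_sin_approximable[OF j]
    have [measurable]: "y \<in> borel_measurable (approximable_algebra s)"
      unfolding y_def by measurable
    have "y -` A \<inter> space (approximable_algebra s) \<in> sets (approximable_algebra s)"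
      using A by measurable
    then have 1: "(\<lambda>x. indicator (y -` A \<inter> space (torus s)) x) \<in> trig_closure s"
      by (simp add: approximable_sets_def)
    note [measurable] = coordinate_measurable[OF j] A
    have S: "{x \<in> space (torus s). x j \<in> A} \<in> sets (torus s)" by measurable
    have "(\<lambda>x. indicator {x \<in> space (torus s). x j \<in> A} x) \<in> trig_closure s"
    proof (rule trig_closure_AE[OF 1])
      show "(\<lambda>x. indicator {x \<in> space (torus s). x j \<in> A} x :: complex) \<in> borel_measurable (torus s)"
        using S by (intro borel_measurable_indicator)
      have "AE x in torus s. x j \<noteq> -pi" "AE x in torus s. x j \<noteq> pi"
        using j by (auto intro!: AE_torus_coordinate_neq)
      then show "AE x in torus s. indicator {x \<in> space (torus s). x j \<in> A} x
          = (indicator (y -` A \<inter> space (torus s)) x :: complex)"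
        using AE_space
      proof eventually_elim
        case (elim x)
        then have "x j \<in> {-pi..pi}" using j by (auto simp: space_torus)
        with elim have "y x = x j" by (simp add: y_def sgn_sin_arccos_cos)
        then show ?case by (auto simp: indicator_def)
      qed
    qed
    with S show ?thesis by (simp add: approximable_sets_def)
  qed
  have "sets (torus s) = sigma_sets (space (torus s))
      {{x \<in> space (torus s). x j \<in> A} | j A. j \<in> {1..s} \<and> A \<in> sets (restrict_space lborel {-pi..pi})}"
    unfolding torus_def sets_PiM_single space_PiM ..
  also have "\<dots> \<subseteq> approximable_sets s"
    by (rule sigma_algebra.sigma_sets_subset[OF sigma_algebra_approximable_sets])
       (auto intro!: gen simp: sets_restrict_space)
  finally show ?thesis .
qed

text \<open>Simple functions are combinations of indicators of approximable sets. A measurable f is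
  a pointwise limit of simple functions bounded by twice its modulus, which is square integrable, so
  dominated convergence applies.\<close>

lemma L2_subset_trig_closure:
  assumes f: "f \<in> L2 s"
  shows "f \<in> trig_closure s"
proof -
  obtain F where F: "\<And>i. simple_function (torus s) (F i)"
    "\<And>x. x \<in> space (torus s) \<Longrightarrow> (\<lambda>i. F i x) \<longlonglongrightarrow> f x"
    "\<And>i x. x \<in> space (torus s) \<Longrightarrow> dist (F i x) 0 \<le> 2 * dist (f x) 0"
    using borel_measurable_implies_sequence_metric[OF L2_measurable[OF f], of 0] by blast
  show ?thesis
  proof (rule trig_closure_dominated)
    show "F i \<in> trig_closure s" for i
    proof (rule trig_closure_AE)
      have "(\<lambda>x. indicator (F i -` {y} \<inter> space (torus s)) x) \<in> trig_closure s" for y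
        using simple_functionD(2)[OF F(1)[of i], of "{y}"] sets_torus_approximable[of s]
        by (auto simp: approximable_sets_def)
      then show "(\<Sum>y\<in>F i ` space (torus s). cscale y (\<lambda>x. indicator (F i -` {y} \<inter> space (torus s)) x))
          \<in> trig_closure s"
        by (intro trig_closure_sum trig_closure_cscale)
      show "F i \<in> borel_measurable (torus s)" by (rule borel_measurable_simple_function[OF F(1)])
      show "AE x in torus s. F i x
          = (\<Sum>y\<in>F i ` space (torus s). cscale y (\<lambda>x. indicator (F i -` {y} \<inter> space (torus s)) x)) x"
      proof (rule AE_I2)
        fix x assume x: "x \<in> space (torus s)"
        show "F i x = (\<Sum>y\<in>F i ` space (torus s).
            cscale y (\<lambda>x. indicator (F i -` {y} \<inter> space (torus s)) x)) x"
          unfolding sum_fun_apply cscale_def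
          by (subst simple_function_indicator_representation_banach[OF F(1) x])
             (intro sum.cong, auto simp: indicator_def)
      qed
    qed
    show "integrable (torus s) (\<lambda>x. (2 * cmod (f x))\<^sup>2)"
      using L2_integrable[OF f] by (simp add: power_mult_distrib)
    show "cmod (F i x) \<le> 2 * cmod (f x)" if "x \<in> space (torus s)" for i x
      using F(3)[OF that] by simp
  qed (use F in auto)
qed

section \<open>Parseval's equation\<close>

lemma inj_on_char_fun: "inj_on (char_fun s) (freqs s)"
proof (rule inj_onI)
  fix k l assume "k \<in> freqs s" "l \<in> freqs s" "char_fun s k = char_fun s l"
  then show "k = l" using L2_inner_char_fun[of k s l] L2_inner_char_fun[of k s k] by (auto split: if_splits)
qed

text \<open>This leads back from arbitrary frequency functions to \<open>freqs s\<close>: only the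
  coordinates in \<open>{1..s}\<close> enter the exponential, so restricting \<open>k\<close> to
  them changes nothing.\<close>

lemma range_char_fun: "range (char_fun s) = char_fun s ` freqs s"
proof -
  have "char_fun s k = char_fun s (restrict k {1..s})" for k by (rule char_fun_cong) auto
  moreover have "restrict k {1..s} \<in> freqs s" for k by (simp add: freqs_def)
  ultimately show ?thesis by blast
qed

lemma trig_polys_trig_sum:
  assumes "p \<in> trig_polys s"
  obtains G c where "finite G" "G \<subseteq> freqs s" "p = trig_sum s G c"
proof -
  obtain T r where T: "finite T" "T \<subseteq> char_fun s ` freqs s" "p = (\<Sum>a\<in>T. cscale (r a) a)"
    using assms unfolding trig_polys_def range_char_fun cfun.span_explicit by auto
  obtain G where G: "G \<subseteq> freqs s" "finite G" "T = char_fun s ` G"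
    using finite_subset_image[OF T(1,2)] by auto
  show ?thesis
  proof (rule that[OF G(2,1)])
    show "p = trig_sum s G (\<lambda>k. r (char_fun s k))"
      unfolding T(3) G(3) by (subst sum.reindex) (auto intro: inj_on_subset[OF inj_on_char_fun G(1)])
  qed
qed

text \<open>This is Parseval's equation in a form without infinite sums. \<open>G\<close> is the set
  of frequencies of an approximating trigonometric polynomial, whose squared error is at least the
  Bessel defect on \<open>G\<close>.\<close>

lemma parseval_approx:
  assumes f: "f \<in> L2 s" and "e > 0"
  obtains G where "finite G" "G \<subseteq> freqs s"
    "(L2_norm s f)\<^sup>2 - (\<Sum>k\<in>G. (cmod (fourier_coeff s f k))\<^sup>2) < e"
proof -
  obtain p where p: "p \<in> trig_polys s" "(L2_norm s (f - p))\<^sup>2 < e"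
    using trig_closure_approx[OF L2_subset_trig_closure[OF f] \<open>e > 0\<close>] by auto
  obtain G c where G: "finite G" "G \<subseteq> freqs s" "p = trig_sum s G c"
    using trig_polys_trig_sum[OF p(1)] by blast
  have "0 \<le> (\<Sum>k\<in>G. (cmod (fourier_coeff s f k - c k))\<^sup>2)" by (intro sum_nonneg) auto
  with p(2) G L2_norm_diff_trig_sum[OF f G(1,2), of c] show ?thesis using that by auto
qed

subsection \<open>Approximation numbers of the Korobov ball\<close>

text \<open>Each norm bounds the other: Parseval is applied to one function and Bessel to the other.
  The purpose is uniqueness of the value described in \<open>korobov_norm\<close>.\<close>

lemma L2_norm_eqI:
  assumes f: "f \<in> L2 s" and g: "g \<in> L2 s"
    and eq: "\<And>k. k \<in> freqs s \<Longrightarrow> fourier_coeff s f k = fourier_coeff s g k"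
  shows "L2_norm s f = L2_norm s g"
proof -
  have le: "(L2_norm s f)\<^sup>2 \<le> (L2_norm s g)\<^sup>2"
    if f: "f \<in> L2 s" and g: "g \<in> L2 s"
      and eq: "\<And>k. k \<in> freqs s \<Longrightarrow> fourier_coeff s f k = fourier_coeff s g k" for f g
  proof (rule field_le_epsilon)
    fix e :: real assume "e > 0"
    obtain G where G: "finite G" "G \<subseteq> freqs s"
      "(L2_norm s f)\<^sup>2 - (\<Sum>k\<in>G. (cmod (fourier_coeff s f k))\<^sup>2) < e"
      using parseval_approx[OF f \<open>e > 0\<close>] by metis
    have "(\<Sum>k\<in>G. (cmod (fourier_coeff s f k))\<^sup>2) = (\<Sum>k\<in>G. (cmod (fourier_coeff s g k))\<^sup>2)"
      using G(2) eq by (intro sum.cong) auto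
    also have "\<dots> \<le> (L2_norm s g)\<^sup>2" by (rule bessel[OF g G(1,2)])
    finally show "(L2_norm s f)\<^sup>2 \<le> (L2_norm s g)\<^sup>2 + e" using G(3) by linarith
  qed
  have "(L2_norm s f)\<^sup>2 = (L2_norm s g)\<^sup>2"
    using le[OF f g] le[OF g f] eq by (simp add: order_antisym)
  then show ?thesis by (simp add: power2_eq_iff_nonneg)
qed

lemma korobov_weight_pos: "a > 0 \<Longrightarrow> korobov_weight s a k > 0"
  by (auto simp: korobov_weight_def intro!: prod_pos)

text \<open>The weights are nonzero, so all admissible \<open>g\<close> share their Fourier
  coefficients and therefore their norm. This discharges the definite description in
  \<open>korobov_norm\<close>.\<close>

lemma korobov_norm_eq:
  assumes a: "a > 0" and g: "g \<in> L2 s" and c: "korobov_conv s r a g f"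
  shows "korobov_norm s r a f = L2_norm s g"
  unfolding korobov_norm_def
proof (rule the_equality)
  show "\<exists>g'\<in>L2 s. korobov_conv s r a g' f \<and> L2_norm s g = L2_norm s g'" using g c by auto
  fix c' assume "\<exists>g'\<in>L2 s. korobov_conv s r a g' f \<and> c' = L2_norm s g'"
  then obtain g' where g': "g' \<in> L2 s" "korobov_conv s r a g' f" "c' = L2_norm s g'" by auto
  have "L2_norm s g' = L2_norm s g"
  proof (rule L2_norm_eqI[OF g'(1) g])
    fix k assume "k \<in> freqs s"
    then have "complex_of_real (korobov_weight s a k powr - r) * fourier_coeff s g' k
      = complex_of_real (korobov_weight s a k powr - r) * fourier_coeff s g k"
      using c g'(2) unfolding korobov_conv_def by metis
    moreover have "complex_of_real (korobov_weight s a k powr - r) \<noteq> 0"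
      using korobov_weight_pos[OF a, of s k] by simp
    ultimately show "fourier_coeff s g' k = fourier_coeff s g k" by (metis mult_left_cancel)
  qed
  with g' show "c' = L2_norm s g" by simp
qed

text \<open>The number compared with \<epsilon> in \<open>small\<close> is the singular value of the
  embedding at k, multiplied by the radius of the ball. Outside \<open>F\<close> it limits the
  coefficients of f to \<open>\<epsilon> / A\<close> times those of g, and Parseval turns this into
  a bound for the error of the partial sum over \<open>F\<close>.\<close>

lemma n_eps_upper:
  assumes a: "a > 0" and \<epsilon>: "\<epsilon> \<ge> 0" and F: "finite F" "F \<subseteq> freqs s"
    and small: "\<And>k. k \<in> freqs s \<Longrightarrow> k \<notin> F \<Longrightarrow> a powr (r * real s) * korobov_weight s a k powr - r \<le> \<epsilon>"
  shows "n_eps \<epsilon> (korobov_ball_star r a s) (L2 s) (L2_norm s) \<le> enat (card F)"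
proof -
  define A where "A = a powr (r * real s)"
  have A: "A > 0" using a by (simp add: A_def)
  define L where "L = cfun.span (char_fun s ` F)"
  have "(SUP f\<in>korobov_ball_star r a s. INF h\<in>L. ereal (L2_norm s (f - h))) \<le> ereal \<epsilon>"
  proof (rule SUP_least)
    fix f assume f: "f \<in> korobov_ball_star r a s"
    then obtain g where g: "f \<in> L2 s" "g \<in> L2 s" "korobov_conv s r a g f"
      by (auto simp: korobov_ball_star_def korobov_space_def)
    have gA: "L2_norm s g \<le> A"
      using f korobov_norm_eq[OF a g(2,3)] by (simp add: korobov_ball_star_def A_def)
    let ?h = "trig_sum s F (fourier_coeff s f)"
    have h: "?h \<in> L"
      unfolding L_def by (intro cfun.span_sum cfun.span_scale cfun.span_base) auto
    \<comment> \<open>Parseval is available only up to an error \<open>e\<close>, so the bound is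
      shown with \<open>e\<close> added, for every positive \<open>e\<close>.\<close>
    have "(L2_norm s (f - ?h))\<^sup>2 \<le> \<epsilon>\<^sup>2"
    proof (rule field_le_epsilon)
      fix e :: real assume "e > 0"
      obtain G where G: "finite G" "G \<subseteq> freqs s"
        "(L2_norm s f)\<^sup>2 - (\<Sum>k\<in>G. (cmod (fourier_coeff s f k))\<^sup>2) < e"
        using parseval_approx[OF g(1) \<open>e > 0\<close>] by metis
      have coeff: "(cmod (fourier_coeff s f k))\<^sup>2 \<le> (\<epsilon> / A)\<^sup>2 * (cmod (fourier_coeff s g k))\<^sup>2"
        if k: "k \<in> G - F" for k
      proof -
        have "korobov_weight s a k powr - r \<le> \<epsilon> / A"
          using small[of k] k G(2) A by (auto simp: A_def field_simps)
        moreover have "cmod (fourier_coeff s f k)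
            = korobov_weight s a k powr - r * cmod (fourier_coeff s g k)"
          using g(3) k G(2) by (auto simp: korobov_conv_def norm_mult)
        ultimately have "cmod (fourier_coeff s f k) \<le> \<epsilon> / A * cmod (fourier_coeff s g k)"
          by (simp only: mult_right_mono norm_ge_zero)
        from power_mono[OF this norm_ge_zero, of 2] show ?thesis by (simp only: power_mult_distrib)
      qed
      have "(\<Sum>k\<in>G. (cmod (fourier_coeff s f k))\<^sup>2) \<le> (\<Sum>k\<in>F \<union> (G - F). (cmod (fourier_coeff s f k))\<^sup>2)"
        using F G by (intro sum_mono2) auto
      also have "\<dots> = (\<Sum>k\<in>F. (cmod (fourier_coeff s f k))\<^sup>2)
          + (\<Sum>k\<in>G - F. (cmod (fourier_coeff s f k))\<^sup>2)"
        using F G by (intro sum.union_disjoint) auto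
      finally have 1: "(\<Sum>k\<in>G. (cmod (fourier_coeff s f k))\<^sup>2) - (\<Sum>k\<in>F. (cmod (fourier_coeff s f k))\<^sup>2)
          \<le> (\<Sum>k\<in>G - F. (cmod (fourier_coeff s f k))\<^sup>2)" by linarith
      also have "\<dots> \<le> (\<Sum>k\<in>G - F. (\<epsilon> / A)\<^sup>2 * (cmod (fourier_coeff s g k))\<^sup>2)"
        by (intro sum_mono coeff)
      also have "\<dots> = (\<epsilon> / A)\<^sup>2 * (\<Sum>k\<in>G - F. (cmod (fourier_coeff s g k))\<^sup>2)"
        by (simp add: sum_distrib_left)
      also have "\<dots> \<le> (\<epsilon> / A)\<^sup>2 * (L2_norm s g)\<^sup>2"
        using G by (intro mult_left_mono bessel g) auto
      also have "\<dots> \<le> (\<epsilon> / A)\<^sup>2 * A\<^sup>2"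
        using gA by (intro mult_left_mono power_mono) auto
      also have "\<dots> = \<epsilon>\<^sup>2" using A by (simp add: power_divide)
      finally show "(L2_norm s (f - ?h))\<^sup>2 \<le> \<epsilon>\<^sup>2 + e"
        using G(3) L2_norm_diff_trig_sum[OF g(1) F, of "fourier_coeff s f"] by simp
    qed
    then have "L2_norm s (f - ?h) \<le> \<epsilon>" using \<epsilon> by (simp add: power2_le_iff_abs_le abs_le_square_iff)
    with h show "(INF h\<in>L. ereal (L2_norm s (f - h))) \<le> ereal \<epsilon>"
      by (intro INF_lower2[of ?h]) auto
  qed
  moreover have "L \<subseteq> L2 s"
    unfolding L_def by (intro cfun.span_minimal L2_subspace) (auto simp: char_fun_L2)
  moreover have "card (char_fun s ` F) \<le> card F" by (rule card_image_le[OF F(1)])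
  ultimately show ?thesis
    unfolding n_eps_def using F(1)
    by (intro Inf_lower CollectI exI[of _ "card F"] exI[of _ L] conjI exI[of _ "char_fun s ` F"])
       (auto simp: L_def)
qed

text \<open>Gaussian elimination: the equation for b is solved for an unknown with nonzero coefficient.\<close>

lemma homogeneous_system_nontrivial_solution:
  fixes v :: "'b \<Rightarrow> 'k \<Rightarrow> 'c::field"
  assumes "finite B" "finite F" "card B < card F"
  shows "\<exists>c. (\<exists>k\<in>F. c k \<noteq> 0) \<and> (\<forall>b\<in>B. (\<Sum>k\<in>F. c k * v b k) = 0)"
  using assms
proof (induction B arbitrary: F v rule: finite_induct)
  case empty
  then have "F \<noteq> {}" by auto
  then show ?case by (intro exI[of _ "\<lambda>_. 1"]) auto
next
  case (insert b B)
  show ?case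
  proof (cases "\<forall>k\<in>F. v b k = 0")
    case True
    obtain c where "\<exists>k\<in>F. c k \<noteq> 0" "\<forall>b\<in>B. (\<Sum>k\<in>F. c k * v b k) = 0"
      using insert.IH[of F v] insert.prems insert.hyps by auto
    with True show ?thesis by (intro exI[of _ c]) auto
  next
    case False
    then obtain i where i: "i \<in> F" "v b i \<noteq> 0" by auto
    define F' where "F' = F - {i}"
    define v' where "v' b' k = v b' k - v b k * v b' i / v b i" for b' k
    have "finite F'" "card B < card F'"
      using insert.prems insert.hyps i by (auto simp: F'_def)
    then obtain c where c: "\<exists>k\<in>F'. c k \<noteq> 0" "\<And>b'. b' \<in> B \<Longrightarrow> (\<Sum>k\<in>F'. c k * v' b' k) = 0"
      using insert.IH[of F' v'] by auto
    define c' where "c' = c(i := - (\<Sum>k\<in>F'. c k * v b k) / v b i)"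
    have split: "(\<Sum>k\<in>F. c' k * w k) = c' i * w i + (\<Sum>k\<in>F'. c k * w k)" for w
    proof -
      have "(\<Sum>k\<in>F. c' k * w k) = c' i * w i + (\<Sum>k\<in>F'. c' k * w k)"
        unfolding F'_def using insert.prems(1) i(1) by (rule sum.remove)
      also have "(\<Sum>k\<in>F'. c' k * w k) = (\<Sum>k\<in>F'. c k * w k)"
        by (intro sum.cong) (auto simp: c'_def F'_def)
      finally show ?thesis .
    qed
    have "(\<Sum>k\<in>F. c' k * v b k) = 0" unfolding split using i by (simp add: c'_def)
    moreover have "(\<Sum>k\<in>F. c' k * v b' k) = 0" if "b' \<in> B" for b'
    proof -
      have "(\<Sum>k\<in>F'. c k * v b' k) = (\<Sum>k\<in>F'. c k * v' b' k + c k * v b k * (v b' i / v b i))"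
        by (intro sum.cong refl) (simp add: v'_def algebra_simps)
      also have "\<dots> = (\<Sum>k\<in>F'. c k * v b k) * (v b' i / v b i)"
        using c(2)[OF that] by (simp only: sum.distrib sum_distrib_right add_0)
      finally show ?thesis unfolding split using i by (simp add: c'_def)
    qed
    moreover have "\<exists>k\<in>F. c' k \<noteq> 0" using c(1) by (auto simp: c'_def F'_def)
    ultimately show ?thesis by (intro exI[of _ c']) auto
  qed
qed

text \<open>A function orthogonal to a subspace is at least as far from it as its own norm. Since
  \<open>n_eps\<close> admits an error equal to \<epsilon>, the singular values on \<open>F\<close>
  are bounded below by some \<delta> strictly above \<epsilon>.\<close>

lemma n_eps_lower:
  assumes a: "a > 0" and \<epsilon>: "0 < \<delta>" "\<epsilon> < \<delta>" and F: "finite F" "F \<subseteq> freqs s"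
    and large: "\<And>k. k \<in> F \<Longrightarrow> \<delta> \<le> a powr (r * real s) * korobov_weight s a k powr - r"
  shows "enat (card F) \<le> n_eps \<epsilon> (korobov_ball_star r a s) (L2 s) (L2_norm s)"
  unfolding n_eps_def
proof (rule Inf_greatest, safe)
  fix n B
  assume L: "cfun.span B \<subseteq> L2 s" and B: "finite B" "card B \<le> n"
    and approx: "(SUP f\<in>korobov_ball_star r a s. INF h\<in>cfun.span B. ereal (L2_norm s (f - h))) \<le> ereal \<epsilon>"
  show "enat (card F) \<le> enat n"
  proof (rule ccontr)
    assume "\<not> enat (card F) \<le> enat n"
    then have "card B < card F" using B by simp
    \<comment> \<open>There is one equation per spanning function and one unknown per frequency, so
      some nonzero trigonometric sum over \<open>F\<close> is orthogonal to all of
      \<open>B\<close>.\<close>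
    from homogeneous_system_nontrivial_solution[OF B(1) F(1) this,
        of "\<lambda>b k. L2_inner s (char_fun s k) b"]
    obtain c where c: "\<exists>k\<in>F. c k \<noteq> 0"
      "\<And>b. b \<in> B \<Longrightarrow> (\<Sum>k\<in>F. c k * L2_inner s (char_fun s k) b) = 0" by blast
    define A where "A = a powr (r * real s)"
    have A: "A > 0" using a by (simp add: A_def)
    define w where "w k = korobov_weight s a k powr r" for k
    have w: "w k > 0" for k using korobov_weight_pos[OF a, of s k] by (simp add: w_def)
    \<comment> \<open>\<open>N\<close> is the Korobov norm of the sum with coefficients
      \<open>c\<close>. The factor \<open>A / N\<close> in \<open>d\<close> moves it to the boundary
      of the ball.\<close>
    define N where "N = sqrt (\<Sum>k\<in>F. (cmod (c k) * w k)\<^sup>2)"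
    have "(\<Sum>k\<in>F. (cmod (c k) * w k)\<^sup>2) > 0"
    proof -
      obtain i where i: "i \<in> F" "c i \<noteq> 0" using c(1) by auto
      have "0 < (cmod (c i) * w i)\<^sup>2" using i w[of i] by simp
      also have "\<dots> \<le> (\<Sum>k\<in>F. (cmod (c k) * w k)\<^sup>2)" using F(1) i by (intro member_le_sum) auto
      finally show ?thesis .
    qed
    then have N: "N > 0" "N\<^sup>2 = (\<Sum>k\<in>F. (cmod (c k) * w k)\<^sup>2)" by (auto simp: N_def)
    define d where "d k = complex_of_real (A / N) * c k" for k
    define f where "f = trig_sum s F d"
    define g where "g = trig_sum s F (\<lambda>k. d k * complex_of_real (w k))"
    have fL: "f \<in> L2 s" and gL: "g \<in> L2 s" by (auto simp: f_def g_def trig_sum_L2)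
    have "(L2_norm s g)\<^sup>2 = (\<Sum>k\<in>F. (A / N)\<^sup>2 * (cmod (c k) * w k)\<^sup>2)"
      unfolding g_def L2_norm_trig_sum[OF F] using A N(1) w
      by (intro sum.cong refl) (simp add: d_def norm_mult power_mult_distrib norm_divide power_divide)
    also have "\<dots> = A\<^sup>2" 
      unfolding sum_distrib_left[symmetric] N(2)[symmetric] using N(1) by (simp add: power_divide)
    finally have gA: "(L2_norm s g)\<^sup>2 = A\<^sup>2" .
    then have gN: "L2_norm s g = A" using A by (simp add: power2_eq_iff_nonneg)
    have "korobov_conv s r a g f"
      unfolding korobov_conv_def f_def g_def
    proof
      fix k assume k: "k \<in> freqs s"
      have "korobov_weight s a k powr - r * w k = 1"
        using korobov_weight_pos[OF a, of s k] by (simp add: w_def powr_minus)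
      then have "complex_of_real (korobov_weight s a k powr - r) * complex_of_real (w k) = 1"
        by (metis of_real_1 of_real_mult)
      then show "fourier_coeff s (trig_sum s F d) k = complex_of_real (korobov_weight s a k powr - r)
          * fourier_coeff s (trig_sum s F (\<lambda>k. d k * complex_of_real (w k))) k"
        by (simp only: fourier_coeff_trig_sum[OF F k]) (simp add: mult.left_commute)
    qed
    with fL gL gN have f: "f \<in> korobov_ball_star r a s"
      using korobov_norm_eq[OF a gL] by (auto simp: korobov_ball_star_def korobov_space_def A_def)
    have fnorm: "\<delta>\<^sup>2 \<le> (L2_norm s f)\<^sup>2"
    proof -
      have "\<delta>\<^sup>2 = (\<delta> / A)\<^sup>2 * (L2_norm s g)\<^sup>2" using A by (simp add: gA power_divide)
      also have "\<dots> = (\<Sum>k\<in>F. (\<delta> / A)\<^sup>2 * (cmod (d k) * w k)\<^sup>2)"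
        unfolding g_def L2_norm_trig_sum[OF F] using w
        by (simp add: sum_distrib_left norm_mult power_mult_distrib)
      also have "\<dots> \<le> (\<Sum>k\<in>F. (cmod (d k))\<^sup>2)"
      proof (rule sum_mono)
        fix k assume k: "k \<in> F"
        \<comment> \<open>By \<open>large\<close>, \<open>w k\<close> is at most
          \<open>A / \<delta>\<close> on \<open>F\<close>: passing from \<open>f\<close> to
          \<open>g\<close> enlarges each coefficient by at most this factor.\<close>
        have "\<delta> * w k \<le> A * korobov_weight s a k powr - r * w k"
          using large[OF k] w[of k] by (simp add: A_def mult_right_mono)
        also have "\<dots> = A"
          using korobov_weight_pos[OF a, of s k] by (simp add: w_def powr_minus)
        finally have "\<delta> / A * w k \<le> 1" using A by (simp add: field_simps)
        moreover have "0 \<le> \<delta> / A * w k" using A \<epsilon> w[of k] by simp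
        ultimately have "(\<delta> / A * w k)\<^sup>2 \<le> 1" by (simp add: power_le_one)
        from mult_right_mono[OF this zero_le_power2[of "cmod (d k)"]]
        show "(\<delta> / A)\<^sup>2 * (cmod (d k) * w k)\<^sup>2 \<le> (cmod (d k))\<^sup>2"
          by (simp only: power_mult_distrib mult_ac mult_1)
      qed
      also have "\<dots> = (L2_norm s f)\<^sup>2" by (simp add: f_def L2_norm_trig_sum[OF F])
      finally show ?thesis .
    qed
    have "ereal \<delta> \<le> (INF h\<in>cfun.span B. ereal (L2_norm s (f - h)))"
    proof (rule INF_greatest)
      fix h assume h: "h \<in> cfun.span B"
      then have hL: "h \<in> L2 s" using L by auto
      have BL: "b \<in> L2 s" if "b \<in> B" for b using that L cfun.span_base by blast
      \<comment> \<open>Square integrability is part of the induction claim because additivity of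
        the inner product requires it of the partial combination.\<close>
      have "h \<in> L2 s \<and> L2_inner s h f = 0"
        using h
      proof (induction rule: cfun.span_induct_alt)
        case base
        show ?case by (rule conjI[OF L2_zero]) (simp add: L2_inner_def)
      next
        case (step z b y)
        have "L2_inner s f b = complex_of_real (A / N) * (\<Sum>k\<in>F. c k * L2_inner s (char_fun s k) b)"
          unfolding f_def using BL[OF step(1)]
          by (simp add: L2_inner_sum_left L2_cscale char_fun_L2 L2_inner_cscale_left d_def
              sum_distrib_left mult.assoc)
        then have "L2_inner s f b = 0" using c(2)[OF step(1)] by simp
        then have "L2_inner s b f = 0" using cnj_L2_inner[of s f b] by simp
        with step BL[OF step(1)] fL have "L2_inner s (cscale z b + y) f = 0"
          by (simp only: L2_inner_add_left[OF L2_cscale] L2_inner_cscale_left mult_zero_right add_0)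
        moreover have "cscale z b + y \<in> L2 s"
          using step BL[OF step(1)] by (intro L2_add L2_cscale) auto
        ultimately show ?case by (rule conjI[rotated])
      qed
      then have "L2_inner s f h = 0" using cnj_L2_inner[of s h f] by simp
      then have "(L2_norm s (f - h))\<^sup>2 = (L2_norm s f)\<^sup>2 + (L2_norm s h)\<^sup>2"
        using L2_norm_diff_sq[OF fL hL] by simp
      with fnorm have "\<delta>\<^sup>2 \<le> (L2_norm s (f - h))\<^sup>2" by (simp add: add_increasing2)
      then have "\<delta> \<le> L2_norm s (f - h)" by (rule power2_le_imp_le) simp
      then show "ereal \<delta> \<le> ereal (L2_norm s (f - h))" by (simp only: ereal_less_eq)
    qed
    also have "\<dots> \<le> (SUP f\<in>korobov_ball_star r a s. INF h\<in>cfun.span B. ereal (L2_norm s (f - h)))"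
      using f by (rule SUP_upper)
    also note approx
    finally show False using \<epsilon> by simp
  qed
qed

text \<open>The radius of the ball absorbs a factor \<open>a powr r\<close> per coordinate. Every
  normalised factor is then at least 1 and equals 1 at frequency 0, so inactive coordinates leave
  the singular value unchanged.\<close>

lemma korobov_weight_scaled:
  assumes "a > 0"
  shows "a powr (r * real s) * korobov_weight s a k powr - r
    = (\<Prod>j=1..s. 1 + of_int \<bar>k j\<bar> / a) powr - r"
proof -
  have "korobov_weight s a k = (\<Prod>j=1..s. a * (1 + of_int \<bar>k j\<bar> / a))"
    unfolding korobov_weight_def using assms by (intro prod.cong) (auto simp: field_simps)
  also have "\<dots> = a powr real s * (\<Prod>j=1..s. 1 + of_int \<bar>k j\<bar> / a)"
    using assms by (simp add: prod.distrib powr_realpow)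
  finally have "korobov_weight s a k powr - r
      = (a powr real s) powr - r * (\<Prod>j=1..s. 1 + of_int \<bar>k j\<bar> / a) powr - r"
    using assms by (simp add: powr_mult prod_nonneg)
  then show ?thesis using assms by (simp add: powr_powr mult.commute powr_minus)
qed

subsection \<open>Tractability\<close>

lemma binomial_le_n_eps:
  assumes a: "a > 0" and r: "r > 0" and \<epsilon>: "\<epsilon> < (1 + 1 / a) powr (- r * real l)"
  shows "enat (s choose l) \<le> n_eps \<epsilon> (korobov_ball_star r a s) (L2 s) (L2_norm s)"
proof -
  define \<iota> where "\<iota> S = (\<lambda>j\<in>{1..s}. if j \<in> S then 1 else 0 :: int)" for S
  define F where "F = \<iota> ` {S. S \<subseteq> {1..s} \<and> card S = l}"
  have "inj_on \<iota> {S. S \<subseteq> {1..s} \<and> card S = l}"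
  proof (rule inj_onI, clarify)
    fix S T assume ST: "S \<subseteq> {1..s}" "T \<subseteq> {1..s}" and eq: "\<iota> S = \<iota> T"
    have "j \<in> S \<longleftrightarrow> j \<in> T" if "j \<in> {1..s}" for j
      using fun_cong[OF eq, of j] that by (simp add: \<iota>_def split: if_splits)
    with ST show "S = T" by blast
  qed
  then have "card F = s choose l"
    unfolding F_def by (simp add: card_image n_subsets)
  moreover have "enat (card F) \<le> n_eps \<epsilon> (korobov_ball_star r a s) (L2 s) (L2_norm s)"
  proof (rule n_eps_lower[OF a _ \<epsilon>])
    show "finite F" by (simp add: F_def)
    show "F \<subseteq> freqs s" by (auto simp: F_def \<iota>_def freqs_def)
    fix k assume "k \<in> F"
    then obtain S where S: "S \<subseteq> {1..s}" "card S = l" "k = \<iota> S" by (auto simp: F_def)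
    have "(\<Prod>j=1..s. 1 + of_int \<bar>k j\<bar> / a) = (\<Prod>j=1..s. if j \<in> S then 1 + 1 / a else 1)"
      by (intro prod.cong) (auto simp: S(3) \<iota>_def)
    also have "\<dots> = (\<Prod>j\<in>{1..s} \<inter> S. 1 + 1 / a)" by (rule prod.inter_restrict[symmetric]) simp
    also have "\<dots> = (1 + 1 / a) ^ l" using S(1,2) by (simp add: Int_absorb1)
    also have "\<dots> = (1 + 1 / a) powr real l" using a by (simp add: powr_realpow add_pos_pos)
    finally show "(1 + 1 / a) powr (- r * real l)
        \<le> a powr (r * real s) * korobov_weight s a k powr - r"
      unfolding korobov_weight_scaled[OF a] by (simp add: powr_powr mult.commute)
  next
    have "1 + 1 / a > 0" using a by (simp add: add_pos_pos)
    then show "0 < (1 + 1 / a) powr (- r * real l)" by (subst powr_gt_zero) simp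
  qed
  ultimately show ?thesis by simp
qed

text \<open>The contradiction arises at a single \<epsilon>. Once the exponent q is given,
  \<open>l\<close> is chosen at least q + 1; the binomial lower bound then grows in s with degree
  \<open>l\<close>, faster than the permitted degree q.\<close>

lemma korobov_polynomially_intractable:
  assumes a: "a > 0" and r: "r > 0"
  shows "polynomially_intractable (korobov_ball_star r a)"
proof
  assume "polynomially_tractable (korobov_ball_star r a)"
  then obtain C p q where C: "C \<ge> 0" "p \<ge> 0" "q \<ge> 0"
    and tract: "\<And>\<epsilon> s. \<epsilon> \<in> {0<..1} \<Longrightarrow> s \<ge> 1 \<Longrightarrow>
        ereal_of_enat (n_eps \<epsilon> (korobov_ball_star r a s) (L2 s) (L2_norm s))
          \<le> ereal (C * real s powr q * \<epsilon> powr (- p))"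
    unfolding polynomially_tractable_def by blast
  define l where "l = nat \<lceil>q\<rceil> + 1"
  have l: "l \<ge> 1" "real l \<ge> q + 1" unfolding l_def by linarith+
  \<comment> \<open>Halving provides the strict inequality that the binomial lower bound
    requires.\<close>
  define \<epsilon> where "\<epsilon> = (1 + 1 / a) powr (- r * real l) / 2"
  have base: "1 + 1 / a > 1" using a by simp
  have e0: "(1 + 1 / a) powr (- r * real l) > 0" using base by (subst powr_gt_zero) linarith
  have "(1 + 1 / a) powr (- r * real l) \<le> (1 + 1 / a) powr 0"
    using base r by (intro powr_mono) auto
  also have "(1 + 1 / a) powr 0 = 1" unfolding powr_zero_eq_one using base by (intro if_not_P) linarith
  finally have \<epsilon>: "\<epsilon> \<in> {0<..1}" "\<epsilon> < (1 + 1 / a) powr (- r * real l)"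
    using e0 unfolding \<epsilon>_def greaterThanAtMost_iff by linarith+
  \<comment> \<open>\<open>K\<close> collects what does not depend on s; the power of
    \<open>l\<close> comes from bounding the binomial coefficient below by the power (s /
    l)^l.\<close>
  define K where "K = C * \<epsilon> powr (- p) * real l ^ l"
  have bound: "real s \<le> K" if s: "s \<ge> l" for s
  proof -
    have s1: "s \<ge> 1" "real s > 0" using s l by auto
    have "ereal_of_enat (enat (s choose l))
        \<le> ereal_of_enat (n_eps \<epsilon> (korobov_ball_star r a s) (L2 s) (L2_norm s))"
      using binomial_le_n_eps[OF a r \<epsilon>(2)] by (simp only: ereal_of_enat_le_iff)
    also have "\<dots> \<le> ereal (C * real s powr q * \<epsilon> powr (- p))" by (rule tract[OF \<epsilon>(1) s1(1)])
    finally have "real (s choose l) \<le> C * real s powr q * \<epsilon> powr (- p)" by simp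
    moreover have "(real s / real l) ^ l \<le> real (s choose l)"
      by (rule binomial_ge_n_over_k_pow_k[OF s])
    ultimately have "real s ^ l / real l ^ l \<le> C * real s powr q * \<epsilon> powr (- p)"
      by (simp add: power_divide)
    then have "real s ^ l \<le> K * real s powr q"
      using l by (simp add: K_def field_simps)
    moreover have "real s * real s powr q \<le> real s ^ l"
    proof -
      have "real s * real s powr q = real s powr (q + 1)" using s1 by (simp add: powr_add)
      also have "\<dots> \<le> real s powr real l" using s1 l by (intro powr_mono) auto
      also have "\<dots> = real s ^ l" using s1 by (simp add: powr_realpow)
      finally show ?thesis .
    qed
    ultimately have "real s * real s powr q \<le> K * real s powr q" by linarith
    then show ?thesis using s1 by simp
  qed
  obtain n where "real n > K" using reals_Archimedean2 by blast
  moreover have "real n \<le> K"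
    using bound[of "max n l"] by (rule order_trans[rotated]) simp_all
  ultimately show False by simp
qed

section \<open>Counting low frequencies and weak tractability\<close>

lemma sum_symmetric_int:
  fixes h :: "int \<Rightarrow> 'a::comm_semiring_1"
  shows "(\<Sum>i\<in>{- int M..int M}. h \<bar>i\<bar>) = h 0 + 2 * (\<Sum>n<M. h (int (Suc n)))"
proof (induction M)
  case (Suc M)
  have "{- int (Suc M)..int (Suc M)} = insert (int (Suc M)) (insert (- int (Suc M)) {- int M..int M})"
    by auto
  then show ?case using Suc by (simp add: algebra_simps mult_2)
qed simp

text \<open>The exponent is split: for nonzero i, \<open>m\<close> of the factors are bounded by
  their value at |i| = 1, which supplies the geometric decay in \<open>m\<close>, and the remaining
  two by a / |i|, which supplies convergence. Euler's value pi^2 / 6, doubled for the two signs,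
  gives pi^2 / 3.\<close>

lemma weight_sum_le:
  assumes a: "a > 0"
  shows "(\<Sum>i\<in>{- int M..int M}. (1 / (1 + of_int \<bar>i\<bar> / a)) ^ (m + 2))
    \<le> 1 + (1 / (1 + 1 / a)) ^ m * (a\<^sup>2 * pi\<^sup>2 / 3)"
proof -
  have summand: "(1 / (1 + of_int (int (Suc n)) / a)) ^ (m + 2)
      \<le> (1 / (1 + 1 / a)) ^ m * (a\<^sup>2 * (1 / (real n + 1)\<^sup>2))" for n
  proof -
    have "1 / (1 + of_int (int (Suc n)) / a) \<le> 1 / (1 + 1 / a)"
      using a by (intro divide_left_mono) (auto intro!: divide_right_mono add_pos_pos mult_pos_pos)
    then have 1: "(1 / (1 + of_int (int (Suc n)) / a)) ^ m \<le> (1 / (1 + 1 / a)) ^ m"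
      using a by (intro power_mono) auto
    have "1 / (1 + of_int (int (Suc n)) / a) \<le> a / (real n + 1)"
      using a by (simp add: field_simps)
    then have "(1 / (1 + of_int (int (Suc n)) / a))\<^sup>2 \<le> (a / (real n + 1))\<^sup>2"
      using a by (intro power_mono) auto
    then have 2: "(1 / (1 + of_int (int (Suc n)) / a))\<^sup>2 \<le> a\<^sup>2 * (1 / (real n + 1)\<^sup>2)"
      by (simp add: power_divide)
    show ?thesis unfolding power_add using a by (intro mult_mono 1 2) auto
  qed
  have basel: "(\<lambda>n. 1 / (real n + 1)\<^sup>2) sums (pi\<^sup>2 / 6)"
    using inverse_squares_sums by (simp add: add.commute)
  have "(\<Sum>n<M. 1 / (real n + 1)\<^sup>2) \<le> pi\<^sup>2 / 6"
    using sum_le_suminf[OF sums_summable[OF basel], of "{..<M}"] sums_unique[OF basel] by simp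
  then have "(1 / (1 + 1 / a)) ^ m * a\<^sup>2 * (\<Sum>n<M. 1 / (real n + 1)\<^sup>2)
      \<le> (1 / (1 + 1 / a)) ^ m * a\<^sup>2 * (pi\<^sup>2 / 6)"
    using a by (intro mult_left_mono) auto
  moreover have "(\<Sum>n<M. (1 / (1 + of_int (int (Suc n)) / a)) ^ (m + 2))
      \<le> (1 / (1 + 1 / a)) ^ m * a\<^sup>2 * (\<Sum>n<M. 1 / (real n + 1)\<^sup>2)"
    unfolding sum_distrib_left by (rule sum_mono) (use summand in \<open>simp only: mult.assoc\<close>)
  ultimately have "(\<Sum>n<M. (1 / (1 + of_int (int (Suc n)) / a)) ^ (m + 2))
      \<le> (1 / (1 + 1 / a)) ^ m * a\<^sup>2 * (pi\<^sup>2 / 6)" by linarith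
  then show ?thesis
    using sum_symmetric_int[of "\<lambda>i. (1 / (1 + of_int i / a)) ^ (m + 2)" M] by simp
qed

text \<open>Rankin's trick: the number of frequencies k with weight w k at most T is at most the sum of
  the numbers (T / w k) ^ p, which factorises.\<close>

lemma low_frequencies_card:
  fixes a T :: real and s :: nat
  assumes a: "a > 0" and T: "T > 0"
  defines "F \<equiv> {k \<in> freqs s. (\<Prod>j=1..s. 1 + of_int \<bar>k j\<bar> / a) \<le> T}"
  shows "finite F"
    and "real (card F) \<le> T ^ (m + 2) * (1 + (1 / (1 + 1 / a)) ^ m * (a\<^sup>2 * pi\<^sup>2 / 3)) ^ s"
proof -
  \<comment> \<open>All factors are at least 1, so each one is at most the product and hence at most
    \<open>T\<close>. This confines every coordinate of a counted frequency to absolute value at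
    most \<open>a * T\<close>.\<close>
  define M where "M = nat \<lceil>a * T\<rceil>"
  define P where "P = {1..s} \<rightarrow>\<^sub>E {- int M..int M}"
  have P: "finite P" by (auto simp: P_def intro!: finite_PiE)
  have FP: "F \<subseteq> P"
  proof
    fix k assume k: "k \<in> F"
    have "\<bar>k j\<bar> \<le> int M" if j: "j \<in> {1..s}" for j
    proof -
      have "1 + of_int \<bar>k j\<bar> / a = (\<Prod>i\<in>{j}. 1 + of_int \<bar>k i\<bar> / a)" by simp
      also have "\<dots> \<le> (\<Prod>i\<in>{1..s}. 1 + of_int \<bar>k i\<bar> / a)"
        using j a by (intro prod_mono2) auto
      also have "\<dots> \<le> T" using k by (simp add: F_def)
      finally have "of_int \<bar>k j\<bar> / a \<le> T" by simp
      then have "of_int \<bar>k j\<bar> \<le> a * T" using a by (simp add: field_simps)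
      then show ?thesis unfolding M_def by linarith
    qed
    moreover have "k \<in> extensional {1..s}" using k by (simp add: F_def freqs_def PiE_iff)
    ultimately show "k \<in> P" unfolding P_def PiE_iff by (simp add: abs_le_iff minus_le_iff)
  qed
  then show "finite F" using P by (rule finite_subset)
  define \<rho> where "\<rho> i = (1 / (1 + of_int \<bar>i\<bar> / a)) ^ (m + 2)" for i :: int
  have \<rho>: "\<rho> i \<ge> 0" for i using a by (simp add: \<rho>_def)
  have "real (card F) = (\<Sum>k\<in>F. 1)" by simp
  also have "\<dots> \<le> (\<Sum>k\<in>F. T ^ (m + 2) * (\<Prod>j=1..s. \<rho> (k j)))"
  proof (rule sum_mono)
    fix k assume k: "k \<in> F"
    define w where "w = (\<Prod>j=1..s. 1 + of_int \<bar>k j\<bar> / a)"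
    have w: "w > 0" "w \<le> T" using a k by (auto simp: w_def F_def intro!: prod_pos add_pos_nonneg)
    have "1 \<le> (T / w) ^ (m + 2)" using w by (intro one_le_power) simp
    also have "\<dots> = T ^ (m + 2) * (1 / w) ^ (m + 2)" by (simp add: power_divide)
    also have "(1 / w) ^ (m + 2) = (\<Prod>j=1..s. \<rho> (k j))"
      unfolding w_def \<rho>_def by (simp only: prod_power_distrib[symmetric] prod_dividef prod.neutral_const)
    finally show "1 \<le> T ^ (m + 2) * (\<Prod>j=1..s. \<rho> (k j))" .
  qed
  \<comment> \<open>Enlarging \<open>F\<close> to a full box is what makes the sum of products a
    product of sums.\<close>
  also have "\<dots> \<le> (\<Sum>k\<in>P. T ^ (m + 2) * (\<Prod>j=1..s. \<rho> (k j)))"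
    using P FP T \<rho> by (intro sum_mono2) (auto intro!: mult_nonneg_nonneg prod_nonneg)
  also have "\<dots> = T ^ (m + 2) * (\<Prod>j=1..s. \<Sum>i\<in>{- int M..int M}. \<rho> i)"
    unfolding P_def by (subst prod_sum_PiE) (auto simp: sum_distrib_left)
  also have "\<dots> = T ^ (m + 2) * (\<Sum>i\<in>{- int M..int M}. \<rho> i) ^ s" by simp
  also have "\<dots> \<le> T ^ (m + 2) * (1 + (1 / (1 + 1 / a)) ^ m * (a\<^sup>2 * pi\<^sup>2 / 3)) ^ s"
    using weight_sum_le[OF a, where m = m and M = M] T \<rho>
    by (intro mult_left_mono power_mono) (auto simp: \<rho>_def[abs_def] intro!: sum_nonneg)
  finally show "real (card F) \<le> T ^ (m + 2) * (1 + (1 / (1 + 1 / a)) ^ m * (a\<^sup>2 * pi\<^sup>2 / 3)) ^ s" .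
qed

text \<open>The estimate \<open>1 + \<kappa> \<le> exp \<kappa>\<close> puts both contributions into
  one exponent. \<open>m\<close> stays free: increasing it raises the coefficient of the logarithm
  and lowers that of s.\<close>

lemma n_eps_korobov_le:
  assumes a: "a > 0" and r: "r > 0" and \<epsilon>: "\<epsilon> > 0"
  obtains N where "n_eps \<epsilon> (korobov_ball_star r a s) (L2 s) (L2_norm s) \<le> enat N"
    and "real N \<le> exp (real (m + 2) / r * ln (1 / \<epsilon>) + real s * ((1 / (1 + 1 / a)) ^ m * (a\<^sup>2 * pi\<^sup>2 / 3)))"
proof -
  \<comment> \<open>The threshold is chosen so that \<open>T powr - r\<close> equals
    \<epsilon>.\<close>
  define T where "T = \<epsilon> powr (- 1 / r)"
  have T: "T > 0" using \<epsilon> by (simp add: T_def)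
  define F where "F = {k \<in> freqs s. (\<Prod>j=1..s. 1 + of_int \<bar>k j\<bar> / a) \<le> T}"
  define \<kappa> where "\<kappa> = (1 / (1 + 1 / a)) ^ m * (a\<^sup>2 * pi\<^sup>2 / 3)"
  have \<kappa>: "\<kappa> \<ge> 0" using a by (simp add: \<kappa>_def)
  note F = low_frequencies_card[OF a T, where s = s, folded F_def]
  have "n_eps \<epsilon> (korobov_ball_star r a s) (L2 s) (L2_norm s) \<le> enat (card F)"
  proof (rule n_eps_upper[OF a _ F(1)])
    fix k assume "k \<in> freqs s" "k \<notin> F"
    then have "T \<le> (\<Prod>j=1..s. 1 + of_int \<bar>k j\<bar> / a)" by (simp add: F_def)
    then have "(\<Prod>j=1..s. 1 + of_int \<bar>k j\<bar> / a) powr - r \<le> T powr - r"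
      using T r by (intro powr_mono2') auto
    also have "\<dots> = \<epsilon>" using \<epsilon> r by (simp add: T_def powr_powr)
    finally show "a powr (r * real s) * korobov_weight s a k powr - r \<le> \<epsilon>"
      by (simp only: korobov_weight_scaled[OF a])
  qed (use \<epsilon> in \<open>auto simp: F_def\<close>)
  moreover have "real (card F) \<le> exp (real (m + 2) / r * ln (1 / \<epsilon>) + real s * \<kappa>)"
  proof -
    have "real (card F) \<le> T ^ (m + 2) * (1 + \<kappa>) ^ s" using F(2)[of m] by (simp only: \<kappa>_def)
    also have "\<dots> \<le> T ^ (m + 2) * exp \<kappa> ^ s"
      using T \<kappa> exp_ge_add_one_self[of \<kappa>] by (intro mult_left_mono power_mono) auto
    also have "T = exp (1 / r * ln (1 / \<epsilon>))" using \<epsilon> by (simp add: T_def powr_def ln_div)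
    also have "exp (1 / r * ln (1 / \<epsilon>)) ^ (m + 2) * exp \<kappa> ^ s
        = exp (real (m + 2) / r * ln (1 / \<epsilon>) + real s * \<kappa>)"
      by (simp only: exp_of_nat_mult[symmetric] exp_add[symmetric]) (simp add: algebra_simps)
    finally show ?thesis .
  qed
  ultimately show ?thesis using that by (simp only: \<kappa>_def)
qed

text \<open>The bound also shows that the logarithm is a real number, so the quotient in
  \<open>weakly_tractable\<close> can be handled in the reals.\<close>

lemma ln_enat_le:
  assumes "n \<le> enat N" "real N \<le> exp B" "B \<ge> 0"
  obtains y where "ln_enat n = ereal y" "0 \<le> y" "y \<le> B"
proof -
  obtain k where k: "n = enat k" "k \<le> N" using assms(1) by (cases n) auto
  show ?thesis
  proof (cases "k = 0")
    \<comment> \<open>Here the convention ln 0 = 0 applies, and 0 lies within the bounds because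
      \<open>B\<close> is nonnegative.\<close>
    case True
    then show ?thesis using that[of 0] k assms(3) by (simp add: ln_enat_def zero_ereal_def)
  next
    case False
    then have "ln (real k) \<le> ln (exp B)" using k assms(2) by (intro ln_mono) auto
    then show ?thesis using that[of "ln (real k)"] False k by (simp add: ln_enat_def)
  qed
qed

lemma korobov_weakly_tractable:
  assumes a: "a > 0" and r: "r > 0"
  shows "weakly_tractable (korobov_ball_star r a)"
proof -
  define v where "v s \<epsilon> = ln_enat (n_eps \<epsilon> (korobov_ball_star r a s) (L2 s) (L2_norm s))
      / ereal (1 / \<epsilon> + real s)" for s \<epsilon>
  define \<F> where "\<F> = filtercomap (\<lambda>(s, \<epsilon>). 1 / \<epsilon> + real s) at_top \<sqinter> principal ({1..} \<times> {0<..1::real})"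
  \<comment> \<open>The lower bound 0 is carried along because convergence in the extended reals is
    checked from both sides.\<close>
  have main: "eventually (\<lambda>(s, \<epsilon>). 0 \<le> v s \<epsilon> \<and> v s \<epsilon> \<le> ereal \<eta>) \<F>" if \<eta>: "\<eta> > 0" for \<eta>
  proof -
    define \<kappa> where "\<kappa> m = (1 / (1 + 1 / a)) ^ m * (a\<^sup>2 * pi\<^sup>2 / 3)" for m
    have "(\<lambda>m. (1 / (1 + 1 / a)) ^ m) \<longlonglongrightarrow> 0"
      using a by (intro LIMSEQ_realpow_zero) (auto simp: divide_less_eq_1 add_pos_pos)
    then have "\<kappa> \<longlonglongrightarrow> 0" unfolding \<kappa>_def by (rule tendsto_mult_left_zero)
    then have "eventually (\<lambda>m. \<kappa> m < \<eta> / 2) sequentially"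
      using \<eta> by (intro order_tendstoD(2)) auto
    \<comment> \<open>\<open>m\<close> depends on \<eta> and \<open>a\<close> only. The term linear
      in s uses up half of \<eta>, and the coefficient \<open>c\<close> of the logarithm is a
      constant from here on.\<close>
    then obtain m where m: "\<kappa> m < \<eta> / 2" by (auto simp: eventually_sequentially)
    have \<kappa>0: "\<kappa> m \<ge> 0" using a by (simp add: \<kappa>_def)
    define c where "c = real (m + 2) / r"
    have c: "c > 0" using r by (simp add: c_def)
    have "((\<lambda>x::real. ln x / x) \<longlongrightarrow> 0) at_top" by (rule ln_x_over_x_tendsto_0)
    then have "eventually (\<lambda>x. ln x / x < \<eta> / (2 * c)) at_top"
      using \<eta> c by (intro order_tendstoD(2)) auto
    \<comment> \<open>This threshold makes \<open>c * ln x\<close> at most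
      \<open>\<eta> / 2 * x\<close>, the other half of the tolerance.\<close>
    then obtain X where X: "\<And>x. x \<ge> X \<Longrightarrow> ln x / x < \<eta> / (2 * c)"
      by (auto simp: eventually_at_top_linorder)
    have "0 \<le> v s \<epsilon> \<and> v s \<epsilon> \<le> ereal \<eta>"
      if s: "s \<ge> 1" and \<epsilon>: "\<epsilon> \<in> {0<..1}" and large: "X \<le> 1 / \<epsilon> + real s" for s \<epsilon>
    proof -
      define x where "x = 1 / \<epsilon> + real s"
      have x: "x > 0" "1 / \<epsilon> \<le> x" "real s \<le> x" "1 / \<epsilon> \<ge> 1"
        using \<epsilon> by (auto simp: x_def add_pos_nonneg)
      obtain N where N: "n_eps \<epsilon> (korobov_ball_star r a s) (L2 s) (L2_norm s) \<le> enat N"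
        "real N \<le> exp (c * ln (1 / \<epsilon>) + real s * \<kappa> m)"
        using n_eps_korobov_le[OF a r, of \<epsilon> s m] \<epsilon> unfolding c_def \<kappa>_def by auto
      have "c * ln (1 / \<epsilon>) + real s * \<kappa> m \<ge> 0"
        using c \<kappa>0 x by (intro add_nonneg_nonneg mult_nonneg_nonneg ln_ge_zero) auto
      from ln_enat_le[OF N this] obtain y where
        y: "ln_enat (n_eps \<epsilon> (korobov_ball_star r a s) (L2 s) (L2_norm s)) = ereal y"
        "0 \<le> y" "y \<le> c * ln (1 / \<epsilon>) + real s * \<kappa> m" by blast
      have "c * ln (1 / \<epsilon>) \<le> c * ln x" using c x \<epsilon> by (intro mult_left_mono ln_mono) auto
      moreover have "ln x / x < \<eta> / (2 * c)" using X large by (simp add: x_def)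
      then have "c * ln x \<le> \<eta> / 2 * x" using c x by (simp add: field_simps)
      moreover have "real s * \<kappa> m \<le> x * (\<eta> / 2)" using x m \<kappa>0 by (intro mult_mono) auto
      moreover have "\<eta> * x = \<eta> / 2 * x + x * (\<eta> / 2)" by (simp add: field_simps)
      ultimately have "y \<le> \<eta> * x" using y(3) by linarith
      then have "0 \<le> y / x \<and> y / x \<le> \<eta>" using x y by (simp add: field_simps)
      moreover have "v s \<epsilon> = ereal (y / x)" using x by (simp add: v_def y x_def[symmetric])
      ultimately show ?thesis by (simp add: zero_ereal_def)
    qed
    then show ?thesis
      unfolding \<F>_def eventually_inf_principal eventually_filtercomap eventually_at_top_linorder
      by (intro exI[of _ "\<lambda>x. X \<le> x"] conjI exI[of _ X]) auto
  qed
  have "((\<lambda>(s, \<epsilon>). v s \<epsilon>) \<longlongrightarrow> 0) \<F>"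
  proof (rule order_tendstoI)
    fix u :: ereal assume "u < 0"
    then show "eventually (\<lambda>z. u < (case z of (s, \<epsilon>) \<Rightarrow> v s \<epsilon>)) \<F>"
      using main[of 1] by (auto elim!: eventually_mono)
  next
    fix u :: ereal assume "0 < u"
    \<comment> \<open>\<open>main\<close> takes a real tolerance, whereas \<open>u\<close> may be
      infinite.\<close>
    then obtain \<eta> where "0 < ereal \<eta>" "ereal \<eta> < u" using ereal_dense2 by blast
    then show "eventually (\<lambda>z. (case z of (s, \<epsilon>) \<Rightarrow> v s \<epsilon>) < u) \<F>"
      using main[of \<eta>] by (auto elim!: eventually_mono)
  qed
  then show ?thesis unfolding weakly_tractable_def v_def \<F>_def .
qed

theorem theorem4p10:
  fixes r a :: real
  assumes "r > 0" and "a > 0"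
  shows "weakly_tractable (korobov_ball_star r a) \<and>
         polynomially_intractable (korobov_ball_star r a)"
  using assms by (simp add: korobov_weakly_tractable korobov_polynomially_intractable)

end
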